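(* Let $p$ be a prime and let $f:\mathbb{Z}_p\times\mathbb{Z}_p\to\mathbb{Z}_p$ be additively inseparable with $\Delta(f)=2$. Let $P$ be a no-signalling box with inputs and outputs in $\mathbb{Z}_p$ that satisfies information causality, and define $$\nu_j=\frac1{p^2}\sum_{x,y=0}^{p-1}\sum_{k=0}^{p-1}P(a=k,\,b=k-f(x,y)+j\mid x,y)\quad\text{for } j\in\mathbb{Z}_p.$$ Then: (i) for every integer $1\le N\le p$ and every $c\in\mathbb{Z}_p$, $$\frac1p\sum_{k=0}^{p-1}\omega_p^{ck}\Big(\sum_{j=0}^{p-1}\nu_j\omega_p^{jk}\Big)^{N-1}\le T_p^{-1}\Big(\frac{N-1}{N}\log_2p\Big);$$ (ii) for every $n\ge1$, with $N=p^n$, and every $c\in\mathbb{Z}_p$, $$\frac1p\sum_{k=0}^{p-1}\omega_p^{ck}\Big(\sum_{j=0}^{p-1}\nu_j\omega_p^{jk}\Big)^{n(p-1)}\le T_p^{-1}\Big(\frac{N-1}{N}\log_2p\Big).$$ Here $\omega_p=e^{2\pi i/p}$.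
   Context: Let $p$ be a prime. All arithmetic on elements of $\mathbb{Z}_p$ is modulo $p$. A box is a conditional probability distribution $P(a,b\mid x,y)$ with $a,b,x,y\in\mathbb{Z}_p$. It is shared by Alice, who supplies $x$ and receives $a$, and Bob, who supplies $y$ and receives $b$. Different copies act independently. $P$ is no-signalling if $\sum_bP(a,b\mid x,y)$ does not depend on $y$ and $\sum_aP(a,b\mid x,y)$ does not depend on $x$. A function $f$ is additively separable if $f(x,y)=g(x)+h(y)$ for some $g,h:\mathbb{Z}_p\to\mathbb{Z}_p$. Otherwise it is additively inseparable. Every $f$ can be written uniquely as $f(x,y)=\sum_{i,j=0}^{p-1}\lambda_{i,j}x^iy^j$. Define $\Delta(f)=\max_{1\le i,j\le p-1}\mathbb{I}_{\lambda_{i,j}\ne0}(i+j)$. Thus $\Delta(f)=2$ means $f(x,y)=\lambda xy+g(x)+h(y)$ with $\lambda\ne0$. $P$ satisfies information causality if, for every $N\ge1$, every protocol of the following form satisfies $\sum_{i=0}^{N-1}I(x_i:b\mid y=i)\le\log_2p$. In the protocol: - Alice receives $\vec x=(x_0,\dots,x_{N-1})$ uniform in $\mathbb{Z}_p^N$, and Bob receives $y$ uniform in $\{0,\dots,N-1\}$, independent of $\vec x$. - They share randomness (independent of the inputs) and finitely many copies of $P$. - Alice's inputs to her ends of the boxes are functions of $\vec x$, the shared randomness, and her previously obtained outputs. - Alice sends a single message $q\in\mathbb{Z}_p$ to Bob, which is a function of $\vec x$, the randomness, and her outputs. - Bob's inputs to his ends of the boxes are functions of $y$, $q$, the shared randomness,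 and his previously obtained outputs. - Bob finally outputs $b\in\mathbb{Z}_p$. Here $I(x_i:b\mid y=i)$ is the Shannon mutual information (in bits) between $x_i$ and $b$ under the distribution conditioned on $y=i$. Let $h(x)=-x\log_2x-(1-x)\log_2(1-x)$ and $T_p(x)=h(x)+(1-x)\log_2(p-1)$. On $[1/p,1]$, $T_p$ decreases strictly from $\log_2p$ to $0$. $T_p^{-1}:[0,\log_2p]\to[1/p,1]$ denotes the inverse of this restriction. *)

theory Defs
  imports Complex_Main "HOL-Computational_Algebra.Primes" "HOL-Library.FuncSet" "HOL-Library.Complex_Order"
begin

text \<open>Elements of Z_p are represented by naturals in {..<p}; arithmetic is mod p.
A box is P a b x y = P(a,b | x,y).\<close>

definition is_box :: "nat \<Rightarrow> (nat \<Rightarrow> nat \<Rightarrow> nat \<Rightarrow> nat \<Rightarrow> real) \<Rightarrow> bool" where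
  "is_box p P \<longleftrightarrow> (\<forall>x<p. \<forall>y<p. (\<forall>a<p. \<forall>b<p. 0 \<le> P a b x y)
      \<and> (\<Sum>a<p. \<Sum>b<p. P a b x y) = 1)"

definition no_signalling :: "nat \<Rightarrow> (nat \<Rightarrow> nat \<Rightarrow> nat \<Rightarrow> nat \<Rightarrow> real) \<Rightarrow> bool" where
  "no_signalling p P \<longleftrightarrow>
     (\<forall>a<p. \<forall>x<p. \<forall>y<p. \<forall>y'<p. (\<Sum>b<p. P a b x y) = (\<Sum>b<p. P a b x y')) \<and>
     (\<forall>b<p. \<forall>x<p. \<forall>x'<p. \<forall>y<p. (\<Sum>a<p. P a b x y) = (\<Sum>a<p. P a b x' y))"

definition add_separable :: "nat \<Rightarrow> (nat \<Rightarrow> nat \<Rightarrow> nat) \<Rightarrow> bool" where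
  "add_separable p f \<longleftrightarrow> (\<exists>g h. (\<forall>x<p. g x < p) \<and> (\<forall>y<p. h y < p) \<and>
      (\<forall>x<p. \<forall>y<p. f x y = (g x + h y) mod p))"

definition poly_coeffs :: "nat \<Rightarrow> (nat \<Rightarrow> nat \<Rightarrow> nat) \<Rightarrow> nat \<Rightarrow> nat \<Rightarrow> nat" where
  "poly_coeffs p f = (THE lam. (\<forall>i j. lam i j < p \<and> ((p \<le> i \<or> p \<le> j) \<longrightarrow> lam i j = 0)) \<and>
      (\<forall>x<p. \<forall>y<p. f x y = (\<Sum>i<p. \<Sum>j<p. lam i j * x ^ i * y ^ j) mod p))"

definition Delta :: "nat \<Rightarrow> (nat \<Rightarrow> nat \<Rightarrow> nat) \<Rightarrow> nat" where
  "Delta p f = Max ({0} \<union> {i + j | i j. 1 \<le> i \<and> i \<le> p - 1 \<and> 1 \<le> j \<and> j \<le> p - 1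
                                  \<and> poly_coeffs p f i j \<noteq> 0})"

definition bin_entropy :: "real \<Rightarrow> real" where
  "bin_entropy x = - x * log 2 x - (1 - x) * log 2 (1 - x)"

definition T_fun :: "nat \<Rightarrow> real \<Rightarrow> real" where
  "T_fun p x = bin_entropy x + (1 - x) * log 2 (real p - 1)"

definition T_inv :: "nat \<Rightarrow> real \<Rightarrow> real" where
  "T_inv p t = (THE x. 1 / real p \<le> x \<and> x \<le> 1 \<and> T_fun p x = t)"

definition omega :: "nat \<Rightarrow> complex" where
  "omega p = cis (2 * pi / real p)"

definition nu :: "nat \<Rightarrow> (nat \<Rightarrow> nat \<Rightarrow> nat) \<Rightarrow> (nat \<Rightarrow> nat \<Rightarrow> nat \<Rightarrow> nat \<Rightarrow> real) \<Rightarrow> nat \<Rightarrow> real" where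
  "nu p f P j = (1 / real p ^ 2) * (\<Sum>x<p. \<Sum>y<p. \<Sum>k<p.
      P k ((k + (p - f x y) + j) mod p) x y)"

text \<open>A history of a party: list of (box index, input, output) in the order of use.\<close>
type_synonym hist = "(nat \<times> nat \<times> nat) list"

text \<open>The next box to be used: the requested one if it is a valid unused box,
otherwise the least unused box (this does not restrict the class of strategies).\<close>
definition pick :: "nat \<Rightarrow> nat \<Rightarrow> hist \<Rightarrow> nat" where
  "pick M c h = (if c < M \<and> c \<notin> fst ` set h then c else (LEAST j. j \<notin> fst ` set h))"

fun run :: "nat \<Rightarrow> nat \<Rightarrow> (hist \<Rightarrow> nat) \<Rightarrow> (hist \<Rightarrow> nat) \<Rightarrow> (nat \<Rightarrow> nat) \<Rightarrow> nat \<Rightarrow> hist" where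
  "run p M nx ip outs 0 = []"
| "run p M nx ip outs (Suc k) =
     (let h = run p M nx ip outs k; c = pick M (nx h) h in h @ [(c, ip h mod p, outs c)])"

definition inp_of :: "hist \<Rightarrow> nat \<Rightarrow> nat" where
  "inp_of h c = (case map_of (map (\<lambda>(c, i, ot). (c, i)) h) c of Some i \<Rightarrow> i | None \<Rightarrow> 0)"

text \<open>Joint distribution of (x_i, b) given y = i, for a protocol with N inputs, M boxes,
shared randomness r in {..<R} with weights w, Alice strategy (nxtA, inpA, Q) and
Bob strategy (nxtB, inpB, Bout).\<close>
definition ic_joint ::
  "nat \<Rightarrow> (nat \<Rightarrow> nat \<Rightarrow> nat \<Rightarrow> nat \<Rightarrow> real) \<Rightarrow> nat \<Rightarrow> nat \<Rightarrow> nat \<Rightarrow> (nat \<Rightarrow> real)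
   \<Rightarrow> ((nat \<Rightarrow> nat) \<Rightarrow> nat \<Rightarrow> hist \<Rightarrow> nat) \<Rightarrow> ((nat \<Rightarrow> nat) \<Rightarrow> nat \<Rightarrow> hist \<Rightarrow> nat)
   \<Rightarrow> ((nat \<Rightarrow> nat) \<Rightarrow> nat \<Rightarrow> hist \<Rightarrow> nat)
   \<Rightarrow> (nat \<Rightarrow> nat \<Rightarrow> nat \<Rightarrow> hist \<Rightarrow> nat) \<Rightarrow> (nat \<Rightarrow> nat \<Rightarrow> nat \<Rightarrow> hist \<Rightarrow> nat)
   \<Rightarrow> (nat \<Rightarrow> nat \<Rightarrow> nat \<Rightarrow> hist \<Rightarrow> nat) \<Rightarrow> nat \<Rightarrow> nat \<Rightarrow> nat \<Rightarrow> real" where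
  "ic_joint p P N M R w nxtA inpA Q nxtB inpB Bout i u v =
    (\<Sum>xs\<in>PiE {..<N} (\<lambda>_. {..<p}). if xs i \<noteq> u then 0 else
     (\<Sum>r<R. \<Sum>a\<in>PiE {..<M} (\<lambda>_. {..<p}). \<Sum>b\<in>PiE {..<M} (\<lambda>_. {..<p}).
        let hA = run p M (nxtA xs r) (inpA xs r) a M;
            q = Q xs r hA mod p;
            hB = run p M (nxtB i q r) (inpB i q r) b M;
            out = Bout i q r hB mod p
        in if out = v then
             (1 / real p ^ N) * w r * (\<Prod>c<M. P (a c) (b c) (inp_of hA c) (inp_of hB c))
           else 0))"

text \<open>Shannon mutual information (bits) of a joint distribution J on {..<p} x {..<p},
with the convention 0 log 0 = 0.\<close>
definition mutual_info :: "nat \<Rightarrow> (nat \<Rightarrow> nat \<Rightarrow> real) \<Rightarrow> real" where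
  "mutual_info p J = (\<Sum>u<p. \<Sum>v<p. J u v *
      log 2 (J u v / ((\<Sum>v'<p. J u v') * (\<Sum>u'<p. J u' v))))"

definition info_causality :: "nat \<Rightarrow> (nat \<Rightarrow> nat \<Rightarrow> nat \<Rightarrow> nat \<Rightarrow> real) \<Rightarrow> bool" where
  "info_causality p P \<longleftrightarrow>
    (\<forall>N M R w nxtA inpA Q nxtB inpB Bout. 1 \<le> N \<longrightarrow> (\<forall>r<R. 0 \<le> w r) \<longrightarrow> (\<Sum>r<R. w r) = 1 \<longrightarrow>
       (\<Sum>i<N. mutual_info p (ic_joint p P N M R w nxtA inpA Q nxtB inpB Bout i)) \<le> log 2 (real p))"

end

theory Submission
  imports Defs "HOL-Real_Asymp.Real_Asymp" "HOL-Computational_Algebra.Polynomial"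
    "HOL-Number_Theory.Cong"
begin

text \<open>
The left-hand sides are Fourier inversions: they equal the probability that a sum of
\<open>m\<close> independent errors distributed according to \<open>\<nu>\<close> takes a prescribed value in
\<open>\<int>\<^sub>p\<close>. Since \<open>f(x,y) = \<lambda>xy + g(x) + h(y)\<close>, shifting both inputs of a box by shared
uniform randomness and correcting the outputs locally turns it into a box computing
\<open>\<lambda>xy\<close> up to an additive error with law exactly \<open>\<nu>\<close>, independent of the inputs.

Such boxes are arranged in a tree. With \<open>D - 1\<close> of them, fed with \<open>x\<^sub>i - x\<^sub>0\<close> by Alice and with
an indicator by Bob, one message in \<open>\<int>\<^sub>p\<close> gives access to any one of \<open>D\<close> values;
nesting this \<open>n\<close> times gives access to any one of \<open>N = D^n\<close> values, and Bob decodes along a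
path that meets \<open>m = n(D - 1)\<close> boxes. His output is the wanted value minus \<open>m\<close> independent
errors, so information causality bounds the entropy of the total error from below by
\<open>(N - 1)/N log p\<close>, and Fano's inequality turns this into the claimed bound.
Part (i) is \<open>D = N, n = 1\<close> and part (ii) is \<open>D = p\<close>.
\<close>

section \<open>Entropy bounds\<close>

text \<open>Only the point \<open>0\<close> needs an argument: the value \<open>0 * log 2 0\<close>
  is \<open>0\<close>, which is also the limit from the right.\<close>

lemma continuous_on_mult_log: "continuous_on {0..} (\<lambda>x::real. x * log 2 x)"
proof -
  have "((\<lambda>x::real. x * log 2 x) \<longlongrightarrow> 0 * log 2 0) (at 0 within {0..})"
  proof -
    have "((\<lambda>x::real. x * log 2 x) \<longlongrightarrow> 0) (at_right 0)" by real_asymp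
    then show ?thesis by (simp add: at_within_Ici_at_right)
  qed
  moreover have "((\<lambda>x::real. x * log 2 x) \<longlongrightarrow> x * log 2 x) (at x within {0..})" if "x > 0" for x
    using that by (intro tendsto_intros) auto
  ultimately show ?thesis
    unfolding continuous_on_def by (metis atLeast_iff order_le_less)
qed

lemma continuous_on_T_fun: "continuous_on {0..1} (T_fun p)"
proof -
  have 1: "continuous_on {0..1} (\<lambda>x::real. x * log 2 x)"
    by (rule continuous_on_subset[OF continuous_on_mult_log]) auto
  have 2: "continuous_on {0..1} (\<lambda>x::real. (1 - x) * log 2 (1 - x))"
    by (rule continuous_on_compose2[OF continuous_on_mult_log, of _ "\<lambda>x. 1 - x"])
       (auto intro!: continuous_intros)
  have "continuous_on {0..1} (\<lambda>x. - (x * log 2 x) - (1 - x) * log 2 (1 - x) + (1 - x) * log 2 (real p - 1))"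
    by (intro continuous_intros 1 2)
  then show ?thesis by (simp add: T_fun_def[abs_def] bin_entropy_def)
qed

text \<open>The derivative at \<open>z\<close> is the logarithm of
  \<open>(1 - z) / (z * (p - 1))\<close>, negative exactly when \<open>z > 1 / p\<close>. Interior
  derivatives and continuity suffice, which avoids the singular end point \<open>1\<close>.\<close>

lemma T_fun_strict_antimono:
  assumes "2 \<le> p" "1 / real p \<le> x" "x < y" "y \<le> 1"
  shows "T_fun p y < T_fun p x"
proof (rule DERIV_neg_imp_decreasing_open[OF assms(3)])
  fix z assume z: "x < z" "z < y"
  have p: "real p \<ge> 2" using assms(1) by simp
  have z0: "1 / real p < z" "z < 1" using z assms by auto
  then have zpos: "0 < z" using p by (meson divide_nonneg_nonneg le_less_trans of_nat_0_le_iff zero_le_one)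
  have "(T_fun p has_real_derivative
      (- ln z + ln (1 - z) - ln (real p - 1)) / ln 2) (at z)"
    unfolding T_fun_def[abs_def] bin_entropy_def log_def
    using zpos z0 by (auto intro!: derivative_eq_intros simp: divide_simps)
  moreover have "(- ln z + ln (1 - z) - ln (real p - 1)) / ln 2 < 0"
  proof -
    have "1 - z < z * (real p - 1)" using z0 p by (simp add: field_simps)
    then have "ln (1 - z) < ln (z * (real p - 1))" using z0 p by (intro ln_less_cancel_iff[THEN iffD2]) auto
    also have "\<dots> = ln z + ln (real p - 1)" using zpos p by (subst ln_mult) auto
    finally show ?thesis by (simp add: divide_neg_pos)
  qed
  ultimately show "\<exists>d. (T_fun p has_real_derivative d) (at z) \<and> d < 0" by blast
next
  have "0 \<le> x" by (rule order_trans[OF _ assms(2)]) simp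
  then show "continuous_on {x..y} (T_fun p)"
    by (intro continuous_on_subset[OF continuous_on_T_fun]) (use assms in auto)
qed

lemma T_fun_inverse_p:
  assumes "2 \<le> p" shows "T_fun p (1 / real p) = log 2 (real p)"
proof -
  have p: "real p \<ge> 2" using assms by simp
  have "1 - 1 / real p = (real p - 1) / real p" using p by (simp add: field_simps)
  then have "log 2 (1 - 1 / real p) = log 2 (real p - 1) - log 2 (real p)"
    using p by (simp add: log_divide)
  moreover have "log 2 (1 / real p) = - log 2 (real p)" using p by (simp add: log_divide)
  ultimately show ?thesis
    unfolding T_fun_def bin_entropy_def by (simp only:) (simp add: algebra_simps)
qed

text \<open>The inverse is a definite description, so existence (intermediate values) and uniqueness
  (strict monotonicity) come first. A point \<open>x\<close> beyond \<open>T_inv p t\<close> would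
  lie on the decreasing branch, giving \<open>T_fun p x < t\<close>.\<close>

lemma le_T_inv:
  assumes p: "2 \<le> p" and t: "0 \<le> t" "t \<le> log 2 (real p)"
    and x: "x \<le> 1" and le: "t \<le> T_fun p x"
  shows "x \<le> T_inv p t"
proof -
  have p1: "1 / real p \<le> 1" "0 \<le> 1 / real p" using p by auto
  have "T_fun p 1 = 0" by (simp add: T_fun_def bin_entropy_def)
  then have "\<exists>z. 1 / real p \<le> z \<and> z \<le> 1 \<and> T_fun p z = t"
    using p1 t T_fun_inverse_p[OF p]
    by (intro IVT2' continuous_on_subset[OF continuous_on_T_fun]) auto
  moreover have "z = z'" if "1 / real p \<le> z \<and> z \<le> 1 \<and> T_fun p z = t"
      "1 / real p \<le> z' \<and> z' \<le> 1 \<and> T_fun p z' = t" for z z'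
    using T_fun_strict_antimono[OF p, of z z'] T_fun_strict_antimono[OF p, of z' z] that
    by (metis linorder_neqE_linordered_idom order_less_irrefl)
  ultimately have "\<exists>!z. 1 / real p \<le> z \<and> z \<le> 1 \<and> T_fun p z = t" by blast
  from theI'[OF this] have z: "1 / real p \<le> T_inv p t" "T_inv p t \<le> 1" "T_fun p (T_inv p t) = t"
    unfolding T_inv_def by auto
  show ?thesis
    using T_fun_strict_antimono[OF p z(1), of x] z x le by force
qed

text \<open>Termwise \<open>ln t \<le> t - 1\<close> at \<open>t = s / (card A * q a)\<close>, with
  \<open>s\<close> the total mass. The mass is left arbitrary because the bound is applied to a
  distribution with one outcome removed.\<close>

lemma gibbs_inequality_uniform:
  fixes q :: "'a \<Rightarrow> real"
  assumes fin: "finite A" and q: "\<And>a. a \<in> A \<Longrightarrow> 0 \<le> q a"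
  shows "- (\<Sum>a\<in>A. q a * log 2 (q a))
    \<le> - sum q A * log 2 (sum q A) + sum q A * log 2 (real (card A))"
proof (cases "sum q A = 0")
  case True
  then have "\<forall>a\<in>A. q a = 0" using fin q by (simp add: sum_nonneg_eq_0_iff)
  then show ?thesis using True by simp
next
  case False
  define s where "s = sum q A"
  have s: "s > 0" using False q sum_nonneg[of A q] by (auto simp: s_def)
  have cpos: "real (card A) > 0" using False fin by (auto simp: card_gt_0_iff)
  have "q a * (ln s - ln (card A) - ln (q a)) \<le> s / card A - q a" if a: "a \<in> A" for a
  proof (cases "q a = 0")
    case True then show ?thesis using s cpos by simp
  next
    case False
    then have qa: "q a > 0" using q[OF a] by simp
    have "ln s - ln (card A) - ln (q a) = ln (s / card A / q a)"
      using s cpos qa by (simp add: ln_div ln_mult)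
    also have "\<dots> \<le> s / card A / q a - 1"
      using s cpos qa by (intro ln_le_minus_one) simp
    finally have "q a * (ln s - ln (card A) - ln (q a)) \<le> q a * (s / card A / q a - 1)"
      using qa by (intro mult_left_mono) auto
    also have "\<dots> = s / card A - q a" using qa by (simp add: field_simps)
    finally show ?thesis .
  qed
  then have "(\<Sum>a\<in>A. q a * (ln s - ln (card A) - ln (q a))) \<le> (\<Sum>a\<in>A. s / card A - q a)"
    by (rule sum_mono)
  also have "\<dots> = 0" using cpos by (simp add: sum_subtractf s_def)
  finally have "s * (ln s - ln (card A)) - (\<Sum>a\<in>A. q a * ln (q a)) \<le> 0"
    by (simp add: right_diff_distrib sum_subtractf sum_distrib_right s_def left_diff_distrib)
  then have "(s * (ln s - ln (card A)) - (\<Sum>a\<in>A. q a * ln (q a))) / ln 2 \<le> 0"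
    by (simp add: divide_nonpos_pos)
  then show ?thesis
    by (simp add: s_def log_def diff_divide_distrib right_diff_distrib sum_divide_distrib)
qed

text \<open>Fano's inequality: the outcome \<open>s\<close> is split off, and the remaining mass
  \<open>1 - q s\<close> has the largest entropy when spread evenly over \<open>p - 1\<close>
  outcomes.\<close>

lemma entropy_le_T_fun:
  fixes q :: "nat \<Rightarrow> real"
  assumes q: "\<And>c. c < p \<Longrightarrow> 0 \<le> q c" and sum1: "(\<Sum>c<p. q c) = 1" and s: "s < p"
  shows "- (\<Sum>c<p. q c * log 2 (q c)) \<le> T_fun p (q s)"
proof -
  have split: "(\<Sum>c<p. F c) = F s + (\<Sum>c\<in>{..<p}-{s}. F c)" for F :: "nat \<Rightarrow> real"
    using s by (intro sum.remove) auto
  have rest: "(\<Sum>c\<in>{..<p}-{s}. q c) = 1 - q s" using split[of q] sum1 by simp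
  have card: "real (card ({..<p}-{s})) = real p - 1" using s by (simp add: of_nat_diff)
  have "- (\<Sum>c\<in>{..<p}-{s}. q c * log 2 (q c))
      \<le> - (1 - q s) * log 2 (1 - q s) + (1 - q s) * log 2 (real p - 1)"
    using gibbs_inequality_uniform[of "{..<p}-{s}" q] q by (simp add: rest card)
  then show ?thesis
    unfolding T_fun_def bin_entropy_def split[of "\<lambda>c. q c * log 2 (q c)"] by (simp add: algebra_simps)
qed

section \<open>Sums over residues and channels with additive noise\<close>

lemma sum_shift_mod:
  fixes G :: "nat \<Rightarrow> 'a::comm_monoid_add"
  assumes "0 < p"
  shows "(\<Sum>r<p. G ((k + r) mod p)) = (\<Sum>r<p. G r)"
proof (rule sum.reindex_bij_witness[where i = "\<lambda>r. (r + (p - k mod p)) mod p"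
      and j = "\<lambda>r. (k + r) mod p"])
  fix r assume r: "r \<in> {..<p}"
  have kp: "k mod p < p" using assms by simp
  show "((k + r) mod p + (p - k mod p)) mod p = r"
  proof -
    have "((k + r) mod p + (p - k mod p)) mod p = (k + (r + (p - k mod p))) mod p"
      by (simp add: mod_add_left_eq add.assoc)
    also have "\<dots> = (k mod p + (r + (p - k mod p))) mod p"
      by (simp add: mod_add_left_eq)
    also have "k mod p + (r + (p - k mod p)) = r + p" using kp by simp
    finally show ?thesis using r by simp
  qed
  show "(k + (r + (p - k mod p)) mod p) mod p = r"
  proof -
    have "(k + (r + (p - k mod p)) mod p) mod p = (k + (r + (p - k mod p))) mod p"
      by (simp add: mod_add_right_eq)
    also have "\<dots> = (k mod p + (r + (p - k mod p))) mod p"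
      by (simp add: mod_add_left_eq)
    also have "k mod p + (r + (p - k mod p)) = r + p" using kp by simp
    finally show ?thesis using r by simp
  qed
qed (use assms in auto)

text \<open>Reflection is an involution of the residues; \<open>v + (p - u)\<close> stands for
  \<open>v - u\<close> without truncation.\<close>

lemma sum_reflect_mod:
  fixes G :: "nat \<Rightarrow> 'a::comm_monoid_add"
  assumes "0 < p" "v < p"
  shows "(\<Sum>u<p. G ((v + (p - u)) mod p)) = (\<Sum>u<p. G u)"
proof -
  have inv: "(v + (p - (v + (p - u)) mod p)) mod p = u" if u: "u < p" for u
  proof (cases "u \<le> v")
    case True
    then have "v + (p - u) = (v - u) + p" using u by simp
    then have "(v + (p - u)) mod p = v - u" using assms by (simp only: mod_add_self2) simp
    moreover have "v + (p - (v - u)) = u + p" using u assms True by simp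
    ultimately show ?thesis using u by simp
  next
    case False
    then have "(v + (p - u)) mod p = v + (p - u)" using u by (intro mod_less) auto
    then show ?thesis using u False by simp
  qed
  show ?thesis
    by (rule sum.reindex_bij_witness[where i = "\<lambda>u. (v + (p - u)) mod p"
        and j = "\<lambda>u. (v + (p - u)) mod p"])
      (use assms inv in \<open>simp_all del: Nat.add_diff_assoc Nat.add_diff_assoc2\<close>)
qed

text \<open>A channel with uniform input and independent additive noise of law \<open>q\<close>:
  both marginals are uniform, so what remains is \<open>log 2 p\<close> minus the entropy of the
  noise.\<close>

lemma mutual_info_shift_invariant:
  fixes q :: "nat \<Rightarrow> real"
  assumes p: "0 < p" and q: "\<And>c. c < p \<Longrightarrow> 0 \<le> q c" and sum1: "(\<Sum>c<p. q c) = 1"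
    and J: "\<And>u v. u < p \<Longrightarrow> v < p \<Longrightarrow> J u v = q ((v + (p - u)) mod p) / real p"
  shows "mutual_info p J = log 2 (real p) + (\<Sum>c<p. q c * log 2 (q c))"
proof -
  have row: "(\<Sum>v<p. J u v) = 1 / real p" if "u < p" for u
  proof -
    have "(\<Sum>v<p. J u v) = (\<Sum>v<p. q (((p - u) + v) mod p)) / real p"
      using that J by (simp add: sum_divide_distrib add.commute)
    then show ?thesis by (simp add: sum_shift_mod[OF p] sum1)
  qed
  have col: "(\<Sum>u<p. J u v) = 1 / real p" if "v < p" for v
  proof -
    have "(\<Sum>u<p. J u v) = (\<Sum>u<p. q ((v + (p - u)) mod p)) / real p"
      using that J by (simp add: sum_divide_distrib)
    then show ?thesis by (simp only: sum_reflect_mod[OF p that] sum1)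
  qed
  \<comment> \<open>This is \<open>q c * log 2 (p * q c)\<close>: the factor \<open>p\<close> is
    what is left after division by the two uniform marginals.\<close>
  define H where "H c = q c * log 2 (q c) + q c * log 2 (real p)" for c
  have "mutual_info p J = (\<Sum>u<p. \<Sum>v<p. H (((p - u) + v) mod p) / real p)"
    unfolding mutual_info_def
  proof (intro sum.cong refl)
    fix u v assume uv: "u \<in> {..<p}" "v \<in> {..<p}"
    define c where "c = (v + (p - u)) mod p"
    have c: "c < p" "((p - u) + v) mod p = c" using p by (auto simp: c_def add.commute)
    have "J u v = q c / real p" using uv J by (simp add: c_def)
    moreover have "q c / real p / (1 / real p * (1 / real p)) = q c * real p"
      using p by (simp add: field_simps)
    ultimately have "J u v * log 2 (J u v / ((\<Sum>v'<p. J u v') * (\<Sum>u'<p. J u' v)))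
        = q c / real p * log 2 (q c * real p)"
      using uv row col by simp
    also have "\<dots> = H c / real p"
      using q[OF c(1)] p by (cases "q c = 0") (simp_all add: H_def log_mult algebra_simps add_divide_distrib)
    finally show "J u v * log 2 (J u v / ((\<Sum>v'<p. J u v') * (\<Sum>u'<p. J u' v)))
        = H (((p - u) + v) mod p) / real p" using c by simp
  qed
  also have "\<dots> = (\<Sum>c<p. H c)"
    using p by (simp only: sum_divide_distrib[symmetric] sum_shift_mod[OF p]) simp
  also have "\<dots> = log 2 (real p) + (\<Sum>c<p. q c * log 2 (q c))"
    by (simp add: H_def sum.distrib sum_distrib_right[symmetric] sum1)
  finally show ?thesis .
qed

section \<open>Polynomial representation modulo a prime\<close>

lemma nat_eq_if_dvd_int_diff:
  assumes "int p dvd int a - int b" "a < p" "b < p"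
  shows "a = b"
  using assms by (metis cong_iff_dvd_diff cong_int_iff cong_less_modulus_unique_nat)

text \<open>Lagrange's bound on the roots of a polynomial over a field, phrased as divisibility of
  an integer polynomial by the constant \<open>q\<close>. A root is split off by synthetic division,
  and primality cancels the factor \<open>b - a\<close> at the other points.\<close>

lemma const_dvd_poly_if_many_roots_mod_prime:
  fixes F :: "int poly" and q :: int
  assumes "prime q" "finite A" "\<And>a b. a \<in> A \<Longrightarrow> b \<in> A \<Longrightarrow> q dvd a - b \<Longrightarrow> a = b"
    "\<And>a. a \<in> A \<Longrightarrow> q dvd poly F a" "degree F < card A"
  shows "[:q:] dvd F"
  using assms
proof (induction "degree F" arbitrary: F A)
  case 0
  then obtain a where "a \<in> A" by fastforce
  moreover obtain c where "F = [:c:]" using 0(1) degree_eq_zeroE by metis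
  ultimately show ?case using 0 by (auto simp: const_poly_dvd_const_poly_iff)
next
  case (Suc d)
  then obtain a where a: "a \<in> A" by fastforce
  define G where "G = synthetic_div F a"
  have F: "F = [:-a, 1:] * G + [:poly F a:]"
    unfolding G_def by (rule synthetic_div_correct'[symmetric])
  have "[:q:] dvd G"
  proof (rule Suc.hyps(1)[of G "A - {a}"])
    show "d = degree G" using Suc.hyps(2) by (simp add: G_def degree_synthetic_div)
    show "degree G < card (A - {a})"
      using Suc.hyps(2) Suc.prems a by (simp add: G_def degree_synthetic_div)
    fix b assume b: "b \<in> A - {a}"
    have "poly F b = (b - a) * poly G b + poly F a"
      by (subst F) (simp add: algebra_simps)
    then have "q dvd (b - a) * poly G b"
      using Suc.prems(4)[of a] Suc.prems(4)[of b] a b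
      by (metis Diff_iff add_diff_cancel_right' dvd_diff)
    then show "q dvd poly G b"
      using Suc.prems(1,3) a b by (metis DiffD1 DiffD2 insertI1 prime_dvd_mult_iff)
  qed (use Suc.prems in auto)
  moreover have "[:q:] dvd [:poly F a:]"
    using Suc.prems(4) a by (simp add: const_poly_dvd_const_poly_iff)
  ultimately show ?case by (subst F) (intro dvd_add dvd_mult)
qed

lemma coeff_dvd_if_vanishing_mod_prime:
  fixes c :: "nat \<Rightarrow> int"
  assumes p: "prime p" and van: "\<And>x. x < p \<Longrightarrow> int p dvd (\<Sum>i<p. c i * int x ^ i)" and i: "i < p"
  shows "int p dvd c i"
proof -
  define F where "F = (\<Sum>i<p. monom (c i) i)"
  have coeff: "coeff F k = (if k < p then c k else 0)" for k
    by (simp add: F_def coeff_sum)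
  have "p > 0" using p prime_gt_0_nat by blast
  then have deg: "degree F < p"
    by (intro degree_lessI) (auto simp: coeff)
  have "[:int p:] dvd F"
  proof (rule const_dvd_poly_if_many_roots_mod_prime[of _ "int ` {..<p}"])
    fix a b assume "a \<in> int ` {..<p}" "b \<in> int ` {..<p}" "int p dvd a - b"
    then show "a = b"
      using nat_eq_if_dvd_int_diff by auto
  next
    fix a assume "a \<in> int ` {..<p}"
    then show "int p dvd poly F a" using van by (auto simp: F_def poly_sum poly_monom)
  qed (use p deg in \<open>auto simp: card_image\<close>)
  then have "int p dvd coeff F i" by (simp add: const_poly_dvd_iff)
  then show ?thesis using coeff[of i] i by simp
qed

lemma coeff2_dvd_if_vanishing_mod_prime:
  fixes c :: "nat \<Rightarrow> nat \<Rightarrow> int"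
  assumes p: "prime p"
    and van: "\<And>x y. x < p \<Longrightarrow> y < p \<Longrightarrow> int p dvd (\<Sum>i<p. \<Sum>j<p. c i j * int x ^ i * int y ^ j)"
    and ij: "i < p" "j < p"
  shows "int p dvd c i j"
proof -
  have "int p dvd (\<Sum>j<p. c i j * int y ^ j)" if y: "y < p" for y
  proof (rule coeff_dvd_if_vanishing_mod_prime[OF p _ ij(1)])
    fix x assume "x < p"
    from van[OF this y] show "int p dvd (\<Sum>i<p. (\<Sum>j<p. c i j * int y ^ j) * int x ^ i)"
      by (simp add: sum_distrib_left sum_distrib_right mult_ac)
  qed
  from coeff_dvd_if_vanishing_mod_prime[OF p this ij(2)] show ?thesis .
qed

text \<open>\<open>poly_coeffs\<close> is a definite description. Uniqueness comes from the
  vanishing lemma; existence is by counting: evaluation maps coefficient tables injectively to value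
  tables, both elements of the same finite set \<open>L\<close>, so it is surjective.\<close>

lemma poly_coeffs_spec:
  assumes p: "prime p" and f: "\<forall>x<p. \<forall>y<p. f x y < p" and xy: "x < p" "y < p"
  shows "f x y = (\<Sum>i<p. \<Sum>j<p. poly_coeffs p f i j * x ^ i * y ^ j) mod p"
    and "poly_coeffs p f i j < p"
proof -
  define ev where "ev lam x y = (\<Sum>i<p. \<Sum>j<p. lam i j * x ^ i * y ^ j) mod p"
    for lam :: "nat \<Rightarrow> nat \<Rightarrow> nat" and x y :: nat
  define S where "S = {..<p} \<times> {..<p}"
  define L where "L = PiE S (\<lambda>_. {..<p})"
  define Phi where "Phi l = restrict (\<lambda>(x,y). ev (curry l) x y) S" for l
  have p0: "p > 0" using p prime_gt_0_nat by blast
  have uniq: "l i j = l' i j"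
    if lt: "\<And>i j. i < p \<Longrightarrow> j < p \<Longrightarrow> l i j < p" "\<And>i j. i < p \<Longrightarrow> j < p \<Longrightarrow> l' i j < p"
      and eq: "\<And>x y. x < p \<Longrightarrow> y < p \<Longrightarrow> ev l x y = ev l' x y" and ij: "i < p" "j < p" for l l' i j
  proof -
    have "int p dvd int (l i j) - int (l' i j)"
    proof (rule coeff2_dvd_if_vanishing_mod_prime[OF p _ ij])
      fix x y assume "x < p" "y < p"
      from eq[OF this] have "int (ev l x y) = int (ev l' x y)" by simp
      then show "int p dvd (\<Sum>i<p. \<Sum>j<p. (int (l i j) - int (l' i j)) * int x ^ i * int y ^ j)"
        unfolding ev_def zmod_int mod_eq_dvd_iff
        by (simp add: sum_subtractf left_diff_distrib)
    qed
    then show ?thesis using lt[OF ij] nat_eq_if_dvd_int_diff by blast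
  qed
  have "finite L" unfolding L_def S_def by (intro finite_PiE) auto
  moreover have "Phi ` L \<subseteq> L"
  proof (intro image_subsetI)
    fix l assume "l \<in> L"
    have "ev (curry l) x y < p" for x y using p0 by (simp add: ev_def)
    then show "Phi l \<in> L" unfolding Phi_def L_def by (intro restrict_PiE[THEN iffD2] Pi_I) auto
  qed
  moreover have "inj_on Phi L"
  proof (rule inj_onI)
    fix l l' assume l: "l \<in> L" "l' \<in> L" "Phi l = Phi l'"
    have eq: "ev (curry l) x y = ev (curry l') x y" if "x < p" "y < p" for x y
      using fun_cong[OF l(3), of "(x, y)"] that by (simp add: Phi_def S_def)
    have lt: "curry l i j < p" "curry l' i j < p" if "i < p" "j < p" for i j
      using l(1,2) that by (auto simp: L_def S_def PiE_iff)
    have "curry l i j = curry l' i j" if "i < p" "j < p" for i j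
      by (rule uniq[OF lt eq that])
    then have "l z = l' z" if "z \<in> S" for z
      using that by (auto simp: S_def)
    then show "l = l'" using l(1,2) unfolding L_def by (intro PiE_ext) auto
  qed
  ultimately have surj: "Phi ` L = L" by (rule endo_inj_surj)
  have "restrict (\<lambda>(x,y). f x y) S \<in> L" using f by (auto simp: L_def S_def)
  then obtain l where l: "l \<in> L" "Phi l = restrict (\<lambda>(x,y). f x y) S" using surj by (metis imageE)
  \<comment> \<open>The description fixes the coefficients outside the square to \<open>0\<close>,
    whereas \<open>l\<close> is \<open>undefined\<close> there.\<close>
  define l1 where "l1 i j = (if i < p \<and> j < p then l (i, j) else 0)" for i j
  let ?spec = "\<lambda>lam. (\<forall>i j. lam i j < p \<and> ((p \<le> i \<or> p \<le> j) \<longrightarrow> lam i j = 0)) \<and>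
      (\<forall>x<p. \<forall>y<p. f x y = (\<Sum>i<p. \<Sum>j<p. lam i j * x ^ i * y ^ j) mod p)"
  have ev1: "ev l1 x y = f x y" if "x < p" "y < p" for x y
  proof -
    have "ev l1 x y = ev (curry l) x y"
      unfolding ev_def by (intro arg_cong[of _ _ "\<lambda>z. z mod p"] sum.cong) (auto simp: l1_def)
    also have "\<dots> = f x y" using fun_cong[OF l(2), of "(x, y)"] that by (simp add: Phi_def S_def)
    finally show ?thesis .
  qed
  have lt1: "l1 i j < p" for i j using l(1) p0 by (auto simp: l1_def L_def S_def PiE_iff)
  have "?spec l1"
  proof (intro conjI allI impI)
    show "l1 i j < p" for i j by (rule lt1)
    show "l1 i j = 0" if "p \<le> i \<or> p \<le> j" for i j using that by (auto simp: l1_def)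
    show "f x y = (\<Sum>i<p. \<Sum>j<p. l1 i j * x ^ i * y ^ j) mod p" if "x < p" "y < p" for x y
      using ev1[OF that] unfolding ev_def by (rule sym)
  qed
  moreover have "lam = l1" if "?spec lam" for lam
  proof (intro ext)
    fix i j
    show "lam i j = l1 i j"
    proof (cases "i < p \<and> j < p")
      case True
      show ?thesis
      proof (rule uniq[of lam l1])
        show "ev lam x y = ev l1 x y" if "x < p" "y < p" for x y
          using ev1[OF that] \<open>?spec lam\<close> that by (simp add: ev_def)
      qed (use that lt1 True in auto)
    next
      case False
      then show ?thesis using that by (auto simp: l1_def)
    qed
  qed
  ultimately have "\<exists>!lam. ?spec lam" by (rule ex1I[of ?spec l1])
  from theI'[OF this] have "?spec (poly_coeffs p f)" unfolding poly_coeffs_def .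
  then show "f x y = (\<Sum>i<p. \<Sum>j<p. poly_coeffs p f i j * x ^ i * y ^ j) mod p"
    and "poly_coeffs p f i j < p" using xy by blast+
qed

text \<open>A mixed monomial of degree above \<open>2\<close> would raise the maximum, and degree
  \<open>2\<close> forces \<open>i = j = 1\<close>; so \<open>xy\<close> is the only mixed monomial,
  and it does occur.\<close>

lemma Delta_eq_2_decomp:
  assumes p: "prime p" and f: "\<forall>x<p. \<forall>y<p. f x y < p" and Delta: "Delta p f = 2"
  obtains lam g h where "\<not> p dvd lam"
    "\<And>x y. x < p \<Longrightarrow> y < p \<Longrightarrow> f x y = (lam * x * y + g x + h y) mod p"
proof -
  let ?c = "poly_coeffs p f"
  let ?S = "{i + j | i j. 1 \<le> i \<and> i \<le> p - 1 \<and> 1 \<le> j \<and> j \<le> p - 1 \<and> ?c i j \<noteq> 0}"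
  have p2: "2 \<le> p" using p prime_ge_2_nat by blast
  have "?S \<subseteq> (\<lambda>(i, j). i + j) ` ({..p} \<times> {..p})" by auto
  then have fin: "finite ({0} \<union> ?S)" using finite_subset by fastforce
  have max2: "Max ({0} \<union> ?S) = 2" using Delta by (simp add: Delta_def)
  have zero: "?c i j = 0" if "1 \<le> i" "i < p" "1 \<le> j" "j < p" "i + j \<noteq> 2" for i j
  proof (rule ccontr)
    assume "?c i j \<noteq> 0"
    then have "i + j \<in> {0} \<union> ?S" using that by force
    from Max_ge[OF fin this] show False using max2 that by auto
  qed
  have "2 \<in> {0} \<union> ?S" using Max_in[OF fin] max2 by (metis Un_insert_left insert_not_empty)
  then obtain i j where ij: "i + j = 2" "1 \<le> i" "1 \<le> j" "?c i j \<noteq> 0" by auto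
  then have "i = 1" "j = 1" by arith+
  then have c11: "?c 1 1 \<noteq> 0" using ij by metis
  have "?c 1 1 < p" by (rule poly_coeffs_spec(2)[OF p f, of 0 0]) (use p2 in auto)
  then have ndvd: "\<not> p dvd ?c 1 1" using c11 by (simp add: nat_dvd_not_less)
  \<comment> \<open>The constant term is counted in \<open>h\<close>, hence the sum for
    \<open>g\<close> starts at \<open>1\<close>.\<close>
  define g where "g x = (\<Sum>i\<in>{1..<p}. ?c i 0 * x ^ i)" for x
  define h where "h y = (\<Sum>j<p. ?c 0 j * y ^ j)" for y
  have "f x y = (?c 1 1 * x * y + g x + h y) mod p" if xy: "x < p" "y < p" for x y
  proof -
    define t where "t i j = ?c i j * x ^ i * y ^ j" for i j
    have split: "(\<Sum>i<p. u i) = u 0 + (\<Sum>i\<in>{1..<p}. u i)" for u :: "nat \<Rightarrow> nat"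
      using p2 by (simp add: lessThan_atLeast0 sum.atLeast_Suc_lessThan)
    have "(\<Sum>j\<in>{1..<p}. t i j) = (if i = 1 then t 1 1 else 0)" if i: "i \<in> {1..<p}" for i
    proof -
      have "(\<Sum>j\<in>{1..<p}. t i j) = (\<Sum>j\<in>{1..<p}. if j = 1 then (if i = 1 then t 1 1 else 0) else 0)"
        using i zero by (intro sum.cong) (auto simp: t_def)
      then show ?thesis using p2 by (simp add: sum.delta)
    qed
    then have "(\<Sum>i\<in>{1..<p}. \<Sum>j\<in>{1..<p}. t i j) = (\<Sum>i\<in>{1..<p}. if i = 1 then t 1 1 else 0)"
      by (intro sum.cong) auto
    also have "\<dots> = t 1 1" using p2 by (simp add: sum.delta)
    finally have "(\<Sum>i<p. \<Sum>j<p. t i j) = h y + (g x + t 1 1)"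
      by (subst split, subst (2) split) (simp add: sum.distrib t_def g_def h_def)
    then show ?thesis using poly_coeffs_spec(1)[OF p f xy] by (simp add: t_def add_ac)
  qed
  with ndvd show ?thesis using that by blast
qed

section \<open>Sums over runs and characters\<close>

text \<open>
This replaces an independence argument: \<open>K c w\<close> may depend on the earlier outcomes, but its total mass
does not.
\<close>

lemma sum_PiE_adaptive_prod:
  fixes K :: "nat \<Rightarrow> (nat \<Rightarrow> 'z) \<Rightarrow> 'z \<Rightarrow> 'c::comm_semiring_1"
  assumes adapted: "\<And>c w w' z. c < M \<Longrightarrow> (\<And>i. i < c \<Longrightarrow> w i = w' i) \<Longrightarrow> K c w z = K c w' z"
    and step: "\<And>c w. c < M \<Longrightarrow> (\<Sum>z\<in>Z. K c w z) = C c"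
  shows "(\<Sum>w\<in>PiE {..<M} (\<lambda>_. Z). \<Prod>c<M. K c w (w c)) = (\<Prod>c<M. C c)"
  using assms
proof (induction M)
  case 0
  then show ?case by simp
next
  case (Suc M)
  have "(\<Sum>w\<in>PiE {..<Suc M} (\<lambda>_. Z). \<Prod>c<Suc M. K c w (w c))
      = (\<Sum>(z, w)\<in>Z \<times> PiE {..<M} (\<lambda>_. Z). \<Prod>c<Suc M. K c (w(M := z)) ((w(M := z)) c))"
    unfolding lessThan_Suc PiE_insert_eq
    by (subst sum.reindex[OF inj_combinator]) (auto simp: case_prod_unfold)
  also have "\<dots> = (\<Sum>(z, w)\<in>Z \<times> PiE {..<M} (\<lambda>_. Z). (\<Prod>c<M. K c w (w c)) * K M w z)"
  proof (intro sum.cong refl, clarify)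
    fix z w
    have "(\<Prod>c<M. K c (w(M := z)) ((w(M := z)) c)) = (\<Prod>c<M. K c w (w c))"
    proof (intro prod.cong refl)
      fix c assume c: "c \<in> {..<M}"
      have "K c (w(M := z)) (w c) = K c w (w c)" by (rule Suc.prems(1)) (use c in auto)
      then show "K c (w(M := z)) ((w(M := z)) c) = K c w (w c)" using c by simp
    qed
    moreover have "K M (w(M := z)) z = K M w z" by (rule Suc.prems(1)) simp_all
    ultimately show "(\<Prod>c<Suc M. K c (w(M := z)) ((w(M := z)) c)) = (\<Prod>c<M. K c w (w c)) * K M w z"
      by simp
  qed
  also have "\<dots> = (\<Sum>w\<in>PiE {..<M} (\<lambda>_. Z). (\<Prod>c<M. K c w (w c)) * (\<Sum>z\<in>Z. K M w z))"
    by (simp add: sum.cartesian_product[symmetric] sum.swap[of _ Z] sum_distrib_left)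
  also have "\<dots> = (\<Prod>c<M. C c) * C M"
    using Suc.IH[OF Suc.prems] Suc.prems(2)[of M] by (simp add: sum_distrib_right[symmetric])
  finally show ?case by simp
qed

text \<open>Used to merge the shifts and both parties' outputs of each box into one outcome, to
  which \<open>sum_PiE_adaptive_prod\<close> applies.\<close>

lemma sum_PiE_Times:
  "(\<Sum>w\<in>PiE I (\<lambda>_. A \<times> B). G w)
    = (\<Sum>f\<in>PiE I (\<lambda>_. A). \<Sum>h\<in>PiE I (\<lambda>_. B). G (\<lambda>i\<in>I. (f i, h i)))"
  unfolding sum.cartesian_product
proof (rule sum.reindex_bij_witness[where i = "\<lambda>(f, h). \<lambda>i\<in>I. (f i, h i)"
      and j = "\<lambda>w. (\<lambda>i\<in>I. fst (w i), \<lambda>i\<in>I. snd (w i))"])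
  fix w assume w: "w \<in> PiE I (\<lambda>_. A \<times> B)"
  show *: "(case (\<lambda>i\<in>I. fst (w i), \<lambda>i\<in>I. snd (w i)) of (f, h) \<Rightarrow> \<lambda>i\<in>I. (f i, h i)) = w"
    using w by (auto simp: fun_eq_iff PiE_def extensional_def)
  show "(\<lambda>i\<in>I. fst (w i), \<lambda>i\<in>I. snd (w i)) \<in> PiE I (\<lambda>_. A) \<times> PiE I (\<lambda>_. B)"
    using w by (auto simp: PiE_iff mem_Times_iff)
  show "(case (\<lambda>i\<in>I. fst (w i), \<lambda>i\<in>I. snd (w i)) of (f, h) \<Rightarrow> G (\<lambda>i\<in>I. (f i, h i))) = G w"
    using * by simp
next
  fix z assume z: "z \<in> PiE I (\<lambda>_. A) \<times> PiE I (\<lambda>_. B)"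
  obtain f h where [simp]: "z = (f, h)" by (cases z)
  have "(\<lambda>i\<in>I. f i) = f" "(\<lambda>i\<in>I. h i) = h" using z by (auto simp: PiE_def)
  moreover have "(\<lambda>i\<in>I. fst ((\<lambda>i\<in>I. (f i, h i)) i)) = (\<lambda>i\<in>I. f i)"
    "(\<lambda>i\<in>I. snd ((\<lambda>i\<in>I. (f i, h i)) i)) = (\<lambda>i\<in>I. h i)" by auto
  ultimately show "(\<lambda>i\<in>I. fst ((case z of (f, h) \<Rightarrow> \<lambda>i\<in>I. (f i, h i)) i),
      \<lambda>i\<in>I. snd ((case z of (f, h) \<Rightarrow> \<lambda>i\<in>I. (f i, h i)) i)) = z" by simp
  show "(case z of (f, h) \<Rightarrow> \<lambda>i\<in>I. (f i, h i)) \<in> PiE I (\<lambda>_. A \<times> B)"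
    using z by (auto simp: PiE_iff)
qed

lemma run_in_order:
  assumes "k \<le> M"
  shows "run p M length ip outs k
    = map (\<lambda>c. (c, ip (run p M length ip outs c) mod p, outs c)) [0..<k]"
  using assms
proof (induction k)
  case 0
  then show ?case by simp
next
  case (Suc k)
  let ?h = "run p M length ip outs k"
  have h: "?h = map (\<lambda>c. (c, ip (run p M length ip outs c) mod p, outs c)) [0..<k]"
    using Suc by simp
  have "length ?h = k" "fst ` set ?h = {0..<k}" by (subst h, force)+
  then have "pick M (length ?h) ?h = k" using Suc.prems by (simp add: pick_def)
  then show ?case using h by (simp add: Let_def)
qed

lemma inp_of_map_upt:
  "c < M \<Longrightarrow> inp_of (map (\<lambda>c. (c, ip c, ot c)) [0..<M]) c = ip c"
  by (simp add: inp_of_def comp_def map_of_map_restrict)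

section \<open>Roots of unity and orthogonality of characters\<close>

lemma omega_power_eq_1_iff:
  assumes "0 < p" shows "omega p ^ m = 1 \<longleftrightarrow> p dvd m"
proof -
  have pw: "omega p ^ k = cis (2 * pi * real k / real p)" for k
    by (simp add: omega_def DeMoivre mult_ac)
  have "omega p ^ p = 1" using assms by (simp add: pw)
  then have "omega p ^ (p * (m div p) + m mod p) = omega p ^ (m mod p)"
    by (simp only: power_add power_mult) simp
  then have m: "omega p ^ m = omega p ^ (m mod p)" by simp
  have "inj_on (\<lambda>k. cis (2 * pi * real k / real p)) {..<p}"
    using bij_betw_roots_unity[OF assms] by (rule bij_betw_imp_inj_on)
  from inj_onD[OF this, of "m mod p" 0] have "omega p ^ (m mod p) = 1 \<longleftrightarrow> m mod p = 0"
    using assms by (auto simp: pw)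
  then show ?thesis using m by (simp add: dvd_eq_mod_eq_0)
qed

text \<open>Divided by \<open>p\<close>, the sum is the indicator of divisibility, the form in which
  Bob's output event is expanded later.\<close>

lemma sum_omega_powers:
  assumes "0 < p"
  shows "(\<Sum>k<p. omega p ^ (m * k)) = (if p dvd m then of_nat p else 0)"
proof (cases "p dvd m")
  case True
  then have "omega p ^ m = 1" using assms by (simp add: omega_power_eq_1_iff)
  then show ?thesis using True by (simp add: power_mult)
next
  case False
  then have "omega p ^ m \<noteq> 1" using assms by (simp add: omega_power_eq_1_iff)
  moreover have "(omega p ^ m) ^ p = 1"
    using omega_power_eq_1_iff[OF assms, of "m * p"] by (simp add: power_mult)
  ultimately show ?thesis using False by (simp add: power_mult geometric_sum)
qed

section \<open>The decoding tree\<close>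

text \<open>
Nodes are numbers below \<open>D^n\<close>; removing the leading base-\<open>D\<close> digit (at position \<open>level D j\<close>)
of \<open>j > 0\<close> leads to its parent. \<open>node_val D n x a l k\<close> is the value Alice has accumulated at node \<open>k\<close>
from its children at positions \<open>\<ge> l\<close>, when \<open>a j\<close> is her corrected output of the box at node \<open>j\<close>.
Bob holding \<open>y\<close> walks through the nodes \<open>y mod D^l\<close>, and needs the boxes in \<open>decode_path D n y\<close>.
\<close>

definition node_val :: "nat \<Rightarrow> nat \<Rightarrow> (nat \<Rightarrow> int) \<Rightarrow> (nat \<Rightarrow> int) \<Rightarrow> nat \<Rightarrow> nat \<Rightarrow> int" where
  "node_val D n x a l k = x k + (\<Sum>l'\<in>{l..<n}. \<Sum>i\<in>{1..<D}. a (k + i * D ^ l'))"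

definition level :: "nat \<Rightarrow> nat \<Rightarrow> nat" where
  "level D j = (LEAST l. j < D ^ Suc l)"

text \<open>The change in accumulated value when Bob's walk passes from the parent
  \<open>j mod D ^ level D j\<close> to \<open>j\<close>. Both values count only children at
  positions above \<open>level D j\<close>, those still ahead of the walk.\<close>

definition node_gap :: "nat \<Rightarrow> nat \<Rightarrow> (nat \<Rightarrow> int) \<Rightarrow> (nat \<Rightarrow> int) \<Rightarrow> nat \<Rightarrow> int" where
  "node_gap D n x a j = node_val D n x a (Suc (level D j)) j
     - node_val D n x a (Suc (level D j)) (j mod D ^ level D j)"

definition decode_path :: "nat \<Rightarrow> nat \<Rightarrow> nat \<Rightarrow> nat set" where
  "decode_path D n y = (\<lambda>(l, i). y mod D ^ l + i * D ^ l) ` ({..<n} \<times> {1..<D})"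

lemma level_add_mult_power:
  assumes "k < D ^ l" "1 \<le> i" "i < D"
  shows "level D (k + i * D ^ l) = l"
  unfolding level_def
proof (rule Least_equality)
  have "k + i * D ^ l < (1 + i) * D ^ l" using assms by simp
  also have "\<dots> \<le> D * D ^ l" using assms by (intro mult_right_mono) auto
  finally show "k + i * D ^ l < D ^ Suc l" by simp
next
  fix l' assume "k + i * D ^ l < D ^ Suc l'"
  moreover have "1 * D ^ l \<le> i * D ^ l" using assms by (intro mult_right_mono) auto
  ultimately have "D ^ l < D ^ Suc l'" by linarith
  then have "l < Suc l'" using assms by (simp only: power_strict_increasing_iff)
  then show "l \<le> l'" by simp
qed

lemma less_power_Suc_level:
  assumes "2 \<le> D" shows "j < D ^ Suc (level D j)"
proof -
  have "j < 2 ^ Suc j" using less_exp[of "Suc j"] by linarith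
  also have "\<dots> \<le> D ^ Suc j" using assms by (rule power_mono) simp
  finally have "j < D ^ Suc j" .
  then show ?thesis unfolding level_def by (rule LeastI)
qed

lemma add_mult_power_less:
  fixes D :: nat
  assumes "k < D ^ l" "i < D" "l < n" shows "k + i * D ^ l < D ^ n"
proof -
  have "k + i * D ^ l < (1 + i) * D ^ l" using assms by simp
  also have "\<dots> \<le> D * D ^ l" using assms by (intro mult_right_mono) auto
  also have "\<dots> = D ^ Suc l" by simp
  also have "\<dots> \<le> D ^ n" using assms by (intro power_increasing) auto
  finally show ?thesis .
qed

text \<open>Both lower bounds on \<open>j\<close> serve \<open>node_gap_cong\<close>: children of a
  node exceed the node, but those of its parent are only known to exceed the node because they are
  at least \<open>D ^ l\<close>.\<close>

lemma node_val_cong: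
  assumes "k < D ^ l" "\<And>j. k < j \<Longrightarrow> D ^ l \<le> j \<Longrightarrow> j < D ^ n \<Longrightarrow> a j = a' j"
  shows "node_val D n x a l k = node_val D n x a' l k"
  unfolding node_val_def
proof (intro arg_cong[of _ _ "\<lambda>s. x k + s"] sum.cong refl assms(2))
  fix l' i assume l': "l' \<in> {l..<n}" and i: "i \<in> {1..<D}"
  have D: "D ^ l \<le> D ^ l'" using l' i by (intro power_increasing) auto
  moreover have "1 * D ^ l' \<le> i * D ^ l'" using i by (intro mult_right_mono) auto
  ultimately show "D ^ l \<le> k + i * D ^ l'" by linarith
  show "k < k + i * D ^ l'" using i by auto
  show "k + i * D ^ l' < D ^ n" using l' i by (intro add_mult_power_less less_le_trans[OF assms(1) D]) auto
qed

text \<open>Causality of the protocol: Alice, working from large nodes to small ones, already knows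
  every output that enters the gap at \<open>j\<close>.\<close>

lemma node_gap_cong:
  assumes D: "2 \<le> D" and eq: "\<And>j'. j < j' \<Longrightarrow> j' < D ^ n \<Longrightarrow> a j' = a' j'"
  shows "node_gap D n x a j = node_gap D n x a' j"
proof -
  have j: "j < D ^ Suc (level D j)" by (rule less_power_Suc_level[OF D])
  moreover have "j mod D ^ level D j < D ^ Suc (level D j)"
    using j by (meson le_less_trans mod_less_eq_dividend)
  ultimately show ?thesis unfolding node_gap_def
    by (intro arg_cong2[of _ _ _ _ "(-)"] node_val_cong eq) auto
qed

lemma inj_on_decode_path:
  fixes D :: nat
  assumes "0 < D"
  shows "inj_on (\<lambda>(l, i). y mod D ^ l + i * D ^ l) ({..<n} \<times> {1..<D})"
proof (rule inj_onI, clarify)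
  fix l i l' i' assume *: "i \<in> {1..<D}" "i' \<in> {1..<D}"
    "y mod D ^ l + i * D ^ l = y mod D ^ l' + i' * D ^ l'"
  have "level D (y mod D ^ l + i * D ^ l) = l" "level D (y mod D ^ l' + i' * D ^ l') = l'"
    using *(1,2) assms by (simp_all add: level_add_mult_power)
  then have "l = l'" using *(3) by simp
  then show "l = l' \<and> i = i'" using * assms by simp
qed

lemma card_decode_path: "0 < D \<Longrightarrow> card (decode_path D n y) = n * (D - 1)"
  unfolding decode_path_def by (subst card_image[OF inj_on_decode_path]) auto

lemma decode_path_subset: assumes "0 < D" shows "decode_path D n y \<subseteq> {1..<D ^ n}"
proof
  fix j assume "j \<in> decode_path D n y"
  then obtain l i where li: "l < n" "1 \<le> i" "i < D" "j = y mod D ^ l + i * D ^ l"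
    by (auto simp: decode_path_def)
  have "j < D ^ n" unfolding li(4) using li assms by (intro add_mult_power_less) auto
  moreover have "0 < i * D ^ l" using li by simp
  moreover have "1 \<le> j" using calculation(2) li(4) by linarith
  ultimately show "j \<in> {1..<D ^ n}" by simp
qed

text \<open>Induction on the number \<open>m\<close> of low digits of \<open>y\<close> processed.
  The invariant: the root value, less the outputs used so far, is the value at node
  \<open>y mod D ^ m\<close> with children from position \<open>m\<close> on, less the errors so
  far. At \<open>m = n\<close> no children remain.\<close>

lemma decode_correct:
  fixes p :: int
  assumes y: "y < D ^ n"
    and b: "\<And>j. j \<in> decode_path D n y \<Longrightarrow>
      [b j = a j - (if j = y mod D ^ Suc (level D j) then node_gap D n x a j else 0) + e j] (mod p)"
  shows "[node_val D n x a 0 0 - (\<Sum>j\<in>decode_path D n y. b j) = x y - (\<Sum>j\<in>decode_path D n y. e j)] (mod p)"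
proof -
  \<comment> \<open>\<open>D = 0\<close> is possible only for \<open>n = 0\<close>, where the path
    is empty.\<close>
  have D0: "n = 0 \<or> 0 < D" using y by (cases "D = 0") (auto simp: power_0_left split: if_splits)
  define nd where "nd l i = y mod D ^ l + i * D ^ l" for l i
  have "[node_val D n x a 0 0 - (\<Sum>l<m. \<Sum>i\<in>{1..<D}. b (nd l i))
      = node_val D n x a m (y mod D ^ m) - (\<Sum>l<m. \<Sum>i\<in>{1..<D}. e (nd l i))] (mod p)"
    if "m \<le> n" for m
    using that
  proof (induction m)
    case 0
    then show ?case by simp
  next
    case (Suc m)
    define k where "k = y mod D ^ m"
    define d where "d = y div D ^ m mod D"
    have D: "0 < D" using D0 Suc.prems by auto
    have km: "k < D ^ m" using D by (simp add: k_def)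
    have kd: "y mod D ^ Suc m = nd m d"
      unfolding power_Suc2 mod_mult2_eq by (simp add: nd_def d_def)
    have d: "d < D" using D by (simp add: d_def)
    let ?W = "node_val D n x a (Suc m)"
    have V: "node_val D n x a m k = ?W k + (\<Sum>i\<in>{1..<D}. a (nd m i))"
      using Suc.prems by (simp add: node_val_def sum.atLeast_Suc_lessThan nd_def k_def)
    have bsum: "[(\<Sum>i\<in>{1..<D}. b (nd m i))
        = (\<Sum>i\<in>{1..<D}. a (nd m i) - (if i = d then ?W (nd m d) - ?W k else 0) + e (nd m i))] (mod p)"
    proof (rule cong_sum)
      fix i assume i: "i \<in> {1..<D}"
      have level: "level D (nd m i) = m" using i km unfolding nd_def k_def
        by (intro level_add_mult_power) auto
      have md: "nd m i mod D ^ m = k" using km by (simp add: nd_def k_def)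
      have eq: "nd m i = y mod D ^ Suc m \<longleftrightarrow> i = d"
        unfolding kd using D by (simp add: nd_def)
      have "nd m i \<in> decode_path D n y" using i Suc.prems by (auto simp: decode_path_def nd_def)
      from b[OF this] show "[b (nd m i)
          = a (nd m i) - (if i = d then ?W (nd m d) - ?W k else 0) + e (nd m i)] (mod p)"
        unfolding node_gap_def level md eq by (simp cong: if_cong)
    qed
    have asum: "(\<Sum>i\<in>{1..<D}. a (nd m i) - (if i = d then ?W (nd m d) - ?W k else 0) + e (nd m i))
        = (\<Sum>i\<in>{1..<D}. a (nd m i)) - (?W (nd m d) - ?W k) + (\<Sum>i\<in>{1..<D}. e (nd m i))"
    \<comment> \<open>A zero digit selects no child: the walk stays at \<open>k\<close>, and the gap
      term vanishes because \<open>nd m d = k\<close>.\<close>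
    proof (cases "d = 0")
      case True
      then have "nd m d = k" by (simp add: nd_def k_def)
      then show ?thesis by (simp add: sum.distrib cong: if_cong)
    next
      case False
      then have "(\<Sum>i\<in>{1..<D}. if i = d then ?W (nd m d) - ?W k else 0) = ?W (nd m d) - ?W k"
        using d by (simp add: sum.delta)
      then show ?thesis by (simp add: sum.distrib sum_subtractf)
    qed
    have "[node_val D n x a 0 0 - (\<Sum>l<m. \<Sum>i\<in>{1..<D}. b (nd l i)) - (\<Sum>i\<in>{1..<D}. b (nd m i))
       = node_val D n x a m k - (\<Sum>l<m. \<Sum>i\<in>{1..<D}. e (nd l i))
         - ((\<Sum>i\<in>{1..<D}. a (nd m i)) - (?W (nd m d) - ?W k) + (\<Sum>i\<in>{1..<D}. e (nd m i)))] (mod p)"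
      unfolding k_def[symmetric] using Suc.prems
      by (intro cong_diff Suc.IH[folded k_def] bsum[unfolded asum]) simp
    then show ?case unfolding kd V by (simp add: algebra_simps)
  qed
  from this[of n] have "[node_val D n x a 0 0 - (\<Sum>l<n. \<Sum>i\<in>{1..<D}. b (nd l i))
      = x y - (\<Sum>l<n. \<Sum>i\<in>{1..<D}. e (nd l i))] (mod p)"
    using y by (simp add: node_val_def)
  moreover have "(\<Sum>j\<in>decode_path D n y. F j) = (\<Sum>l<n. \<Sum>i\<in>{1..<D}. F (nd l i))" for F :: "nat \<Rightarrow> int"
    using D0
  proof
    assume "0 < D"
    then show ?thesis unfolding decode_path_def sum.cartesian_product
      by (subst sum.reindex[OF inj_on_decode_path]) (auto simp: nd_def case_prod_unfold)
  qed (simp add: decode_path_def)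
  ultimately show ?thesis by simp
qed

section \<open>Reindexing and counting\<close>

lemma sum_Times_Times:
  fixes F :: "'a \<times> 'b \<Rightarrow> 'c \<Rightarrow> 'd \<Rightarrow> 'e::comm_monoid_add"
  shows "(\<Sum>(rs, a, b)\<in>(A \<times> B) \<times> C \<times> E. F rs a b) = (\<Sum>r\<in>A. \<Sum>s\<in>B. \<Sum>a\<in>C. \<Sum>b\<in>E. F (r, s) a b)"
proof -
  have "(\<Sum>r\<in>A. \<Sum>s\<in>B. \<Sum>a\<in>C. \<Sum>b\<in>E. F (r, s) a b) = (\<Sum>(r, s)\<in>A \<times> B. \<Sum>a\<in>C. \<Sum>b\<in>E. F (r, s) a b)"
    by (rule sum.cartesian_product)
  also have "\<dots> = (\<Sum>rs\<in>A \<times> B. \<Sum>a\<in>C. \<Sum>b\<in>E. F rs a b)"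
    by (rule sum.cong) auto
  also have "\<dots> = (\<Sum>rs\<in>A \<times> B. \<Sum>(a, b)\<in>C \<times> E. F rs a b)"
    by (rule sum.cong[OF refl]) (rule sum.cartesian_product)
  also have "\<dots> = (\<Sum>(rs, a, b)\<in>(A \<times> B) \<times> C \<times> E. F rs a b)"
    by (rule sum.cartesian_product)
  finally show ?thesis by (rule sym)
qed

lemma card_PiE_fixed_component:
  assumes i: "i < N" and u: "u < p"
  shows "card {xs \<in> PiE {..<N} (\<lambda>_. {..<p}). xs i = u} = p ^ (N - 1)"
proof -
  let ?B = "\<lambda>k. if k = i then {u} else {..<p}"
  have "{xs \<in> PiE {..<N} (\<lambda>_. {..<p}). xs i = u} = PiE {..<N} ?B"
  proof (intro equalityI subsetI)
    fix xs assume xs: "xs \<in> PiE {..<N} ?B"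
    have B: "xs k \<in> ?B k" if "k < N" for k
      using PiE_mem[OF xs] that by simp
    have "xs k < p" if "k < N" for k
      using B[OF that] u by (cases "k = i") simp_all
    moreover have "xs i = u" using B[OF i] by simp
    ultimately show "xs \<in> {xs \<in> PiE {..<N} (\<lambda>_. {..<p}). xs i = u}"
      using xs by (simp add: PiE_iff)
  qed (simp add: PiE_iff)
  then have "card {xs \<in> PiE {..<N} (\<lambda>_. {..<p}). xs i = u} = (\<Prod>k<N. card (?B k))"
    by (simp only: card_PiE finite_lessThan)
  also have "\<dots> = card (?B i) * (\<Prod>k\<in>{..<N} - {i}. card (?B k))"
    using i by (intro prod.remove) auto
  also have "(\<Prod>k\<in>{..<N} - {i}. card (?B k)) = (\<Prod>k\<in>{..<N} - {i}. p)"
    by (rule prod.cong[OF refl]) simp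
  also have "\<dots> = p ^ (N - 1)" using i by simp
  finally show ?thesis by simp
qed

section \<open>The protocol\<close>

text \<open>
The box at node \<open>j\<close> has index \<open>M - j\<close>, so that using the boxes in the order of their indices handles
children before their parents. \<open>rho c = (r, s)\<close> is the shared shift of the two inputs of box \<open>c\<close>.
\<close>

locale tree_protocol =
  fixes p lam mu D n :: nat and f :: "nat \<Rightarrow> nat \<Rightarrow> nat" and g h :: "nat \<Rightarrow> nat"
    and P :: "nat \<Rightarrow> nat \<Rightarrow> nat \<Rightarrow> nat \<Rightarrow> real"
  assumes p2: "2 \<le> p" and D0: "0 < D"
    and f_eq: "\<And>x y. x < p \<Longrightarrow> y < p \<Longrightarrow> f x y = (lam * x * y + g x + h y) mod p"
    and lam_mu: "[lam * mu = 1] (mod p)"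
    and box: "is_box p P"
begin

abbreviation "M \<equiv> D ^ n - 1"

text \<open>
Writing \<open>X = \<alpha> + r\<close> and \<open>Y = \<beta> + s\<close>, the identity \<open>XY = \<alpha>\<beta> + r\<beta> + Xs\<close> splits \<open>f(X,Y) - \<lambda>\<alpha>\<beta>\<close> into
\<open>\<lambda>Xs + g(X)\<close>, which Alice subtracts in \<open>corr\<close>, and \<open>\<lambda>r\<beta> + h(Y)\<close>, which Bob adds in \<open>decB\<close>.
\<close>

definition corr :: "(nat \<Rightarrow> nat \<times> nat) \<Rightarrow> hist \<Rightarrow> nat \<Rightarrow> int" where
  "corr rho H j = (case H ! (M - j) of (_, X, a) \<Rightarrow> int a - int (lam * X * snd (rho (M - j)) + g X))"

text \<open>The intended input of the next box, whose node is \<open>M - length H\<close>. Since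
  \<open>mu\<close> inverts \<open>lam\<close>, multiplication by \<open>lam\<close> in the box
  restores the gap.\<close>

definition alpha :: "(nat \<Rightarrow> nat) \<Rightarrow> (nat \<Rightarrow> nat \<times> nat) \<Rightarrow> hist \<Rightarrow> nat" where
  "alpha xs rho H = nat ((int mu * node_gap D n (\<lambda>k. int (xs k)) (corr rho H) (M - length H)) mod int p)"

definition inA :: "(nat \<Rightarrow> nat) \<Rightarrow> (nat \<Rightarrow> nat \<times> nat) \<Rightarrow> hist \<Rightarrow> nat" where
  "inA xs rho H = (alpha xs rho H + fst (rho (length H))) mod p"

definition msg :: "(nat \<Rightarrow> nat) \<Rightarrow> (nat \<Rightarrow> nat \<times> nat) \<Rightarrow> hist \<Rightarrow> nat" where
  "msg xs rho H = nat (node_val D n (\<lambda>k. int (xs k)) (corr rho H) 0 0 mod int p)"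

definition beta :: "nat \<Rightarrow> nat \<Rightarrow> nat" where
  "beta y c = (if M - c = y mod D ^ Suc (level D (M - c)) then 1 else 0)"

definition inB :: "nat \<Rightarrow> (nat \<Rightarrow> nat \<times> nat) \<Rightarrow> nat \<Rightarrow> nat" where
  "inB y rho c = (beta y c + snd (rho c)) mod p"

definition decB :: "nat \<Rightarrow> nat \<Rightarrow> (nat \<Rightarrow> nat \<times> nat) \<Rightarrow> (nat \<Rightarrow> nat) \<Rightarrow> nat" where
  "decB y q rho b = nat ((int q - (\<Sum>j\<in>decode_path D n y. int (b (M - j))
      + int (lam * fst (rho (M - j)) * beta y (M - j) + h (inB y rho (M - j))))) mod int p)"

definition trA :: "(nat \<Rightarrow> nat) \<Rightarrow> (nat \<Rightarrow> nat \<times> nat) \<Rightarrow> (nat \<Rightarrow> nat) \<Rightarrow> nat \<Rightarrow> hist" where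
  "trA xs rho a = run p M length (inA xs rho) a"

definition XA :: "(nat \<Rightarrow> nat) \<Rightarrow> (nat \<Rightarrow> nat \<times> nat) \<Rightarrow> (nat \<Rightarrow> nat) \<Rightarrow> nat \<Rightarrow> nat" where
  "XA xs rho a c = inA xs rho (trA xs rho a c)"

text \<open>The deviation \<open>b - (a - f)\<close> modulo \<open>p\<close>, matching the index
  \<open>j\<close> in \<open>nu\<close>; \<open>p - a c\<close> keeps the subtraction from
  truncating.\<close>

definition err :: "(nat \<Rightarrow> nat) \<Rightarrow> nat \<Rightarrow> (nat \<Rightarrow> nat \<times> nat) \<Rightarrow> (nat \<Rightarrow> nat) \<Rightarrow> (nat \<Rightarrow> nat) \<Rightarrow> nat \<Rightarrow> nat" where
  "err xs y rho a b c = (b c + (p - a c) + f (XA xs rho a c) (inB y rho c)) mod p"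

section \<open>Causal structure of Alice's transcript\<close>

lemma D_ge_2: "c < M \<Longrightarrow> 2 \<le> D"
  using D0 by (cases "D = 1") auto

lemma inA_less: "inA xs rho H < p" and inB_less: "inB y rho c < p"
  using p2 by (simp_all add: inA_def inB_def)

lemma XA_less: "XA xs rho a c < p"
  by (simp add: XA_def inA_less)

lemma trA_eq: "k \<le> M \<Longrightarrow> trA xs rho a k = map (\<lambda>c. (c, XA xs rho a c, a c)) [0..<k]"
  unfolding trA_def XA_def by (subst run_in_order) (auto simp: mod_less[OF inA_less])

lemma length_trA: "k \<le> M \<Longrightarrow> length (trA xs rho a k) = k"
  by (simp add: trA_eq)

lemma corr_trA:
  "M - j < k \<Longrightarrow> k \<le> M \<Longrightarrow> corr rho (trA xs rho a k) j
    = int (a (M - j)) - int (lam * XA xs rho a (M - j) * snd (rho (M - j)) + g (XA xs rho a (M - j)))"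
  by (simp add: corr_def trA_eq)

lemma alpha_cong:
  assumes "length H < M" "\<And>c. c < length H \<Longrightarrow> rho c = rho' c"
  shows "alpha xs rho H = alpha xs rho' H"
proof -
  have "node_gap D n x (corr rho H) (M - length H) = node_gap D n x (corr rho' H) (M - length H)" for x
  proof (rule node_gap_cong[OF D_ge_2[OF assms(1)]])
    fix j assume "M - length H < j" "j < D ^ n"
    then have "M - j < length H" using assms(1) by linarith
    then show "corr rho H j = corr rho' H j" using assms(2) by (simp add: corr_def)
  qed
  then show ?thesis by (simp add: alpha_def)
qed

lemma trA_cong:
  assumes "k \<le> M" "\<And>c. c < k \<Longrightarrow> rho c = rho' c" "\<And>c. c < k \<Longrightarrow> a c = a' c"
  shows "trA xs rho a k = trA xs rho' a' k"
  using assms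
proof (induction k)
  case 0
  then show ?case by (simp add: trA_def)
next
  case (Suc k)
  then have IH: "trA xs rho a k = trA xs rho' a' k" by simp
  have len: "length (trA xs rho' a' k) = k" using Suc.prems by (simp add: length_trA)
  have XAk: "XA xs rho a k = XA xs rho' a' k"
    unfolding XA_def IH inA_def
    using alpha_cong[of "trA xs rho' a' k" rho rho'] Suc.prems len by simp
  have "trA xs rho a (Suc k) = trA xs rho a k @ [(k, XA xs rho a k, a k)]"
    "trA xs rho' a' (Suc k) = trA xs rho' a' k @ [(k, XA xs rho' a' k, a' k)]"
    using Suc.prems(1) by (simp_all add: trA_eq)
  then show ?case using IH XAk Suc.prems by simp
qed

lemma XA_eq: "k \<le> M \<Longrightarrow> XA xs rho a k = (alpha xs rho (trA xs rho a k) + fst (rho k)) mod p"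
  by (simp add: XA_def inA_def length_trA)

text \<open>Agreement is asked for only below \<open>k\<close>: the intended input does not involve
  the shift of box \<open>k\<close> itself, so this shift can be averaged over with the intended
  input held fixed. It also yields adaptedness for \<open>sum_PiE_adaptive_prod\<close>.\<close>

lemma alpha_trA_cong:
  assumes "k < M" "\<And>c. c < k \<Longrightarrow> rho c = rho' c" "\<And>c. c < k \<Longrightarrow> a c = a' c"
  shows "alpha xs rho (trA xs rho a k) = alpha xs rho' (trA xs rho' a' k)"
  using trA_cong[of k rho rho' a a'] assms alpha_cong[of "trA xs rho' a' k" rho rho']
  by (simp add: length_trA)

text \<open>When box \<open>M - j\<close> is about to be used, exactly the nodes above
  \<open>j\<close> have outputs, and the gap at \<open>j\<close> depends on no others; so the
  complete history may replace the partial one.\<close>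

lemma int_alpha:
  assumes "1 \<le> j" "j \<le> M"
  shows "[int (alpha xs rho (trA xs rho a (M - j)))
    = int mu * node_gap D n (\<lambda>k. int (xs k)) (corr rho (trA xs rho a M)) j] (mod int p)"
proof -
  have "node_gap D n (\<lambda>k. int (xs k)) (corr rho (trA xs rho a (M - j))) j
      = node_gap D n (\<lambda>k. int (xs k)) (corr rho (trA xs rho a M)) j"
  proof (rule node_gap_cong)
    show "2 \<le> D" using assms by (intro D_ge_2[of "M - j"]) auto
    fix j' assume "j < j'" "j' < D ^ n"
    then have "M - j' < M - j" using assms by linarith
    then show "corr rho (trA xs rho a (M - j)) j' = corr rho (trA xs rho a M) j'"
      by (subst (1 2) corr_trA) auto
  qed
  then show ?thesis using assms p2 by (simp add: alpha_def length_trA cong_def)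
qed

section \<open>Bob's output as the wanted value minus the total error\<close>

lemma output_cong:
  assumes y: "y < D ^ n" and a: "\<And>c. c < M \<Longrightarrow> a c < p"
  shows "[int (decB y (msg xs rho (trA xs rho a M)) rho b)
    = int (xs y) - (\<Sum>j\<in>decode_path D n y. int (err xs y rho a b (M - j)))] (mod int p)"
proof -
  define A where "A = corr rho (trA xs rho a M)"
  define B where "B j = int (b (M - j)) + int (lam * fst (rho (M - j)) * beta y (M - j) + h (inB y rho (M - j)))" for j
  have key: "[node_val D n (\<lambda>k. int (xs k)) A 0 0 - (\<Sum>j\<in>decode_path D n y. B j)
      = int (xs y) - (\<Sum>j\<in>decode_path D n y. int (err xs y rho a b (M - j)))] (mod int p)"
  proof (rule decode_correct[OF y])
    fix j assume "j \<in> decode_path D n y"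
    then have j: "1 \<le> j" "j \<le> M" using decode_path_subset[OF D0, of n y] by fastforce+
    define c where "c = M - j"
    have c: "c < M" and Mc: "M - c = j" using j by (auto simp: c_def)
    define X where "X = XA xs rho a c"
    define Y where "Y = inB y rho c"
    define al where "al = alpha xs rho (trA xs rho a c)"
    define r s where "r = fst (rho c)" and "s = snd (rho c)"
    define be where "be = beta y c"
    define gap where "gap = node_gap D n (\<lambda>k. int (xs k)) A j"
    define J where "J = err xs y rho a b c"
    have dX: "int p dvd int X - (int al + int r)"
      using c by (simp add: X_def XA_eq al_def r_def zmod_int mod_eq_dvd_iff[symmetric])
    have dY: "int p dvd int Y - (int be + int s)"
      by (simp add: Y_def inB_def be_def s_def zmod_int mod_eq_dvd_iff[symmetric])
    have dL: "int p dvd int lam * int mu - 1"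
      using lam_mu by (metis cong_iff_dvd_diff cong_int_iff of_nat_1 of_nat_mult)
    have da: "int p dvd int al - int mu * gap"
      using int_alpha[OF j] by (simp add: al_def c_def gap_def A_def cong_iff_dvd_diff)
    have df: "int p dvd int (f X Y) - (int lam * int X * int Y + int (g X) + int (h Y))"
      using f_eq[of X Y] XA_less inB_less
      by (simp add: X_def Y_def zmod_int mod_eq_dvd_iff[symmetric])
    have dJ: "int p dvd int J - (int (b c) - int (a c) + int (f X Y))"
    proof -
      have "int (b c + (p - a c) + f X Y) = int (b c) + (int p - int (a c)) + int (f X Y)"
        using a[OF c] by linarith
      then have "int J = (int (b c) + (int p - int (a c)) + int (f X Y)) mod int p"
        unfolding J_def err_def X_def Y_def zmod_int by (simp only:)
      then have "int p dvd int J - (int (b c) + (int p - int (a c)) + int (f X Y))"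
        by (metis mod_eq_dvd_iff mod_mod_trivial)
      then have "int p dvd (int J - (int (b c) + (int p - int (a c)) + int (f X Y))) + int p"
        by (rule dvd_add) (rule dvd_refl)
      also have "(int J - (int (b c) + (int p - int (a c)) + int (f X Y))) + int p
          = int J - (int (b c) - int (a c) + int (f X Y))" by simp
      finally show ?thesis .
    qed
    have "A j = int (a c) - int (lam * X * s + g X)"
      unfolding A_def c_def X_def s_def using j by (subst corr_trA) auto
    moreover have "B j = int (b c) + int (lam * r * be + h Y)"
      by (simp add: B_def c_def r_def be_def Y_def)
    \<comment> \<open>The combination rewrites \<open>lam * X * Y\<close> step by step:
      \<open>Y\<close> into \<open>be + s\<close>, then \<open>X\<close> in the \<open>be\<close>
      term into \<open>al + r\<close>, then \<open>al\<close> into \<open>mu * gap\<close>, and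
      finally \<open>lam * mu\<close> into \<open>1\<close>. The last two summands insert the error
      and the form of \<open>f\<close>.\<close>
    ultimately have "B j - (A j - int be * gap + int J)
      = - (int be * int lam * (int al - int mu * gap) + int be * gap * (int lam * int mu - 1)
        + int lam * int be * (int X - (int al + int r)) + int lam * int X * (int Y - (int be + int s))
        + (int J - (int (b c) - int (a c) + int (f X Y)))
        + (int (f X Y) - (int lam * int X * int Y + int (g X) + int (h Y))))"
      by (simp add: algebra_simps)
    also have "int p dvd \<dots>"
      unfolding dvd_minus_iff using dX dY dL da df dJ by (intro dvd_add) auto
    finally have "[B j = A j - int be * gap + int J] (mod int p)"
      by (simp add: cong_iff_dvd_diff)
    moreover have "int be * gap = (if j = y mod D ^ Suc (level D j) then node_gap D n (\<lambda>k. int (xs k)) A j else 0)"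
      unfolding be_def beta_def Mc gap_def by simp
    ultimately show "[B j = A j - (if j = y mod D ^ Suc (level D j) then node_gap D n (\<lambda>k. int (xs k)) A j else 0)
        + int (err xs y rho a b (M - j))] (mod int p)"
      by (simp add: J_def c_def)
  qed
  have "[int (msg xs rho (trA xs rho a M)) - (\<Sum>j\<in>decode_path D n y. B j)
      = node_val D n (\<lambda>k. int (xs k)) A 0 0 - (\<Sum>j\<in>decode_path D n y. B j)] (mod int p)"
    using p2 by (intro cong_diff) (auto simp: msg_def A_def cong_def)
  moreover have "[int (decB y (msg xs rho (trA xs rho a M)) rho b)
      = int (msg xs rho (trA xs rho a M)) - (\<Sum>j\<in>decode_path D n y. B j)] (mod int p)"
    using p2 unfolding decB_def B_def by (simp add: cong_def)
  ultimately show ?thesis using key cong_trans by blast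
qed

text \<open>Divisibility of a natural number is the form to which \<open>sum_omega_powers\<close>
  applies; the extra \<open>p\<close> avoids a negative difference.\<close>

lemma output_eq_iff:
  assumes y: "y < D ^ n" and a: "\<And>c. c < M \<Longrightarrow> a c < p" and xs: "xs y < p" and v: "v < p"
  shows "decB y (msg xs rho (trA xs rho a M)) rho b mod p = v
    \<longleftrightarrow> p dvd v + (p - xs y) + (\<Sum>j\<in>decode_path D n y. err xs y rho a b (M - j))"
proof -
  let ?o = "decB y (msg xs rho (trA xs rho a M)) rho b"
  let ?S = "\<Sum>j\<in>decode_path D n y. err xs y rho a b (M - j)"
  have oc: "[int ?o = int (xs y) - int ?S] (mod int p)"
    unfolding of_nat_sum by (rule output_cong[OF y a])
  have "?o mod p = v \<longleftrightarrow> [int v = int ?o] (mod int p)"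
    unfolding cong_int_iff using v by (auto simp: cong_def)
  also have "\<dots> \<longleftrightarrow> [int v = int (xs y) - int ?S] (mod int p)"
    unfolding cong_def by (simp only: oc[unfolded cong_def])
  also have "\<dots> \<longleftrightarrow> int p dvd int v - (int (xs y) - int ?S)"
    by (simp add: cong_iff_dvd_diff)
  also have "\<dots> \<longleftrightarrow> int p dvd (int v - (int (xs y) - int ?S)) + int p"
    by (simp only: dvd_add_left_iff[OF dvd_refl])
  also have "(int v - (int (xs y) - int ?S)) + int p = int (v + (p - xs y) + ?S)"
    using xs by linarith
  finally show ?thesis by (simp only: of_nat_dvd_iff)
qed

section \<open>Law of the error of one shifted box\<close>

text \<open>Uniform shifts average over all input pairs whatever \<open>al\<close> and
  \<open>be\<close> are, so the error has law \<open>nu\<close> independently of the intended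
  inputs. The test function \<open>phi\<close> stays free: it will be a character at boxes on Bob's
  path and \<open>1\<close> elsewhere.\<close>

lemma nu_sum_eq:
  fixes phi :: "nat \<Rightarrow> complex"
  shows "(\<Sum>(rs, a, b)\<in>({..<p} \<times> {..<p}) \<times> {..<p} \<times> {..<p}.
      complex_of_real (P a b ((al + fst rs) mod p) ((be + snd rs) mod p) / real p ^ 2)
        * phi ((b + (p - a) + f ((al + fst rs) mod p) ((be + snd rs) mod p)) mod p))
    = (\<Sum>j<p. complex_of_real (nu p f P j) * phi j)"
proof -
  have p0: "0 < p" using p2 by simp
  have swap3: "(\<Sum>x<p. \<Sum>y<p. \<Sum>j<p. T x y j) = (\<Sum>j<p. \<Sum>x<p. \<Sum>y<p. T x y j)"
    for T :: "nat \<Rightarrow> nat \<Rightarrow> nat \<Rightarrow> complex"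
  proof -
    have "(\<Sum>x<p. \<Sum>y<p. \<Sum>j<p. T x y j) = (\<Sum>x<p. \<Sum>j<p. \<Sum>y<p. T x y j)"
      by (rule sum.cong[OF refl]) (rule sum.swap)
    also have "\<dots> = (\<Sum>j<p. \<Sum>x<p. \<Sum>y<p. T x y j)" by (rule sum.swap)
    finally show ?thesis .
  qed
  define G where "G x y = (\<Sum>a<p. \<Sum>b<p. complex_of_real (P a b x y / real p ^ 2) * phi ((b + (p - a) + f x y) mod p))" for x y
  have "(\<Sum>(rs, a, b)\<in>({..<p} \<times> {..<p}) \<times> {..<p} \<times> {..<p}.
      complex_of_real (P a b ((al + fst rs) mod p) ((be + snd rs) mod p) / real p ^ 2)
        * phi ((b + (p - a) + f ((al + fst rs) mod p) ((be + snd rs) mod p)) mod p))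
    = (\<Sum>r<p. \<Sum>s<p. G ((al + r) mod p) ((be + s) mod p))"
    unfolding sum_Times_Times by (simp add: G_def)
  also have "\<dots> = (\<Sum>x<p. \<Sum>y<p. G x y)"
    by (simp only: sum_shift_mod[OF p0, of "\<lambda>y. G x y" for x]
        sum_shift_mod[OF p0, of "\<lambda>x. \<Sum>y<p. G x y"])
  also have "\<dots> = (\<Sum>x<p. \<Sum>y<p. \<Sum>j<p. \<Sum>a<p.
      complex_of_real (P a ((a + (p - f x y) + j) mod p) x y / real p ^ 2) * phi j)"
  proof (intro sum.cong refl)
    fix x y assume "x \<in> {..<p}" "y \<in> {..<p}"
    then have fxy: "f x y < p" using f_eq p0 by simp
    have "(\<Sum>b<p. complex_of_real (P a b x y / real p ^ 2) * phi ((b + (p - a) + f x y) mod p))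
      = (\<Sum>j<p. complex_of_real (P a ((a + (p - f x y) + j) mod p) x y / real p ^ 2) * phi j)"
      if a: "a < p" for a
    proof -
      let ?H = "\<lambda>b. complex_of_real (P a b x y / real p ^ 2) * phi ((b + (p - a) + f x y) mod p)"
      \<comment> \<open>Substituting \<open>b = a - f x y + j\<close> makes the error equal to
        \<open>j\<close>, as in the definition of \<open>nu\<close>.\<close>
      have "(\<Sum>b<p. ?H b) = (\<Sum>j<p. ?H ((a + (p - f x y) + j) mod p))"
        by (rule sum_shift_mod[OF p0, symmetric])
      also have "\<dots> = (\<Sum>j<p. complex_of_real (P a ((a + (p - f x y) + j) mod p) x y / real p ^ 2) * phi j)"
      proof (rule sum.cong[OF refl])
        fix j assume j: "j \<in> {..<p}"
        have "((a + (p - f x y) + j) mod p + (p - a) + f x y) mod p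
            = ((a + (p - f x y) + j) + ((p - a) + f x y)) mod p"
          by (metis add.assoc mod_add_left_eq)
        also have "(a + (p - f x y) + j) + ((p - a) + f x y) = j + p * 2" using a fxy by simp
        also have "\<dots> mod p = j" using j by (simp only: mod_mult_self2) simp
        finally show "?H ((a + (p - f x y) + j) mod p)
            = complex_of_real (P a ((a + (p - f x y) + j) mod p) x y / real p ^ 2) * phi j"
          by simp
      qed
      finally show ?thesis .
    qed
    then have "G x y = (\<Sum>a<p. \<Sum>j<p. complex_of_real (P a ((a + (p - f x y) + j) mod p) x y / real p ^ 2) * phi j)"
      unfolding G_def by (rule sum.cong[OF refl]) (simp only: lessThan_iff)
    also have "\<dots> = (\<Sum>j<p. \<Sum>a<p. complex_of_real (P a ((a + (p - f x y) + j) mod p) x y / real p ^ 2) * phi j)"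
      by (rule sum.swap)
    finally show "G x y = (\<Sum>j<p. \<Sum>a<p. complex_of_real (P a ((a + (p - f x y) + j) mod p) x y / real p ^ 2) * phi j)" .
  qed
  also have "\<dots> = (\<Sum>j<p. \<Sum>x<p. \<Sum>y<p. \<Sum>a<p.
      complex_of_real (P a ((a + (p - f x y) + j) mod p) x y / real p ^ 2) * phi j)"
    by (rule swap3)
  also have "\<dots> = (\<Sum>j<p. complex_of_real (nu p f P j) * phi j)"
    by (simp add: nu_def sum_distrib_left sum_distrib_right sum_divide_distrib)
  finally show ?thesis .
qed

lemma sum_nu: "(\<Sum>j<p. complex_of_real (nu p f P j)) = 1"
proof -
  have p0: "0 < p" using p2 by simp
  have "(\<Sum>a<p. \<Sum>b<p. P a b x y / real p ^ 2) = 1 / real p ^ 2" if "x < p" "y < p" for x y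
    using that box by (simp add: is_box_def sum_divide_distrib[symmetric])
  then have "(\<Sum>r<p. \<Sum>s<p. \<Sum>a<p. \<Sum>b<p. P a b ((0 + r) mod p) ((0 + s) mod p) / real p ^ 2)
      = (\<Sum>r<p. \<Sum>s<p. 1 / real p ^ 2)"
    by (intro sum.cong refl) simp
  also have "\<dots> = 1" using p0 by (simp add: power2_eq_square)
  finally have "complex_of_real (\<Sum>r<p. \<Sum>s<p. \<Sum>a<p. \<Sum>b<p. P a b ((0 + r) mod p) ((0 + s) mod p) / real p ^ 2) = 1"
    by simp
  then show ?thesis
    using nu_sum_eq[of 0 0 "\<lambda>_. 1"] unfolding sum_Times_Times by simp
qed

definition nu_hat :: "nat \<Rightarrow> complex" where
  "nu_hat k = (\<Sum>j<p. complex_of_real (nu p f P j) * omega p ^ (j * k))"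

text \<open>One factor per box: a box on the path contributes \<open>nu_hat k\<close>, any other box
  its total mass \<open>1\<close>. Alice's inputs depend on earlier outcomes, but by
  \<open>nu_sum_eq\<close> the factors do not.\<close>

lemma character_sum:
  "(\<Sum>rho\<in>PiE {..<M} (\<lambda>_. {..<p} \<times> {..<p}). \<Sum>a\<in>PiE {..<M} (\<lambda>_. {..<p}). \<Sum>b\<in>PiE {..<M} (\<lambda>_. {..<p}).
      complex_of_real ((1 / real p ^ 2) ^ M * (\<Prod>c<M. P (a c) (b c) (XA xs rho a c) (inB y rho c)))
       * omega p ^ ((\<Sum>j\<in>decode_path D n y. err xs y rho a b (M - j)) * k))
    = nu_hat k ^ (n * (D - 1))"
proof -
  define S where "S = (\<lambda>j. M - j) ` decode_path D n y"
  have sub: "decode_path D n y \<subseteq> {1..<D ^ n}" by (rule decode_path_subset[OF D0])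
  have inj: "inj_on (\<lambda>j. M - j) (decode_path D n y)"
  proof (rule inj_onI)
    fix j j' assume "j \<in> decode_path D n y" "j' \<in> decode_path D n y" and eq: "M - j = M - j'"
    then have "j \<in> {1..<D ^ n}" "j' \<in> {1..<D ^ n}" using sub by blast+
    then show "j = j'" using eq unfolding atLeastLessThan_iff by linarith
  qed
  have SM: "S \<subseteq> {..<M}"
  proof
    fix c assume "c \<in> S"
    then obtain j where "j \<in> {1..<D ^ n}" "c = M - j" using sub by (auto simp: S_def)
    then show "c \<in> {..<M}" by auto
  qed
  have cardS: "card S = n * (D - 1)" unfolding S_def using inj D0 by (simp add: card_image card_decode_path)
  define phi where "phi c j = (if c \<in> S then omega p ^ (j * k) else 1)" for c j
  define rho' where "rho' w = (\<lambda>c. fst (w c))" for w :: "nat \<Rightarrow> (nat \<times> nat) \<times> nat \<times> nat"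
  define a' where "a' w = (\<lambda>c. fst (snd (w c)))" for w :: "nat \<Rightarrow> (nat \<times> nat) \<times> nat \<times> nat"
  \<comment> \<open>Alice's intended input at box \<open>c\<close> is recomputed from
    \<open>w\<close> below \<open>c\<close>, while the current shift and outputs come from
    \<open>z\<close>, as adaptedness demands.\<close>
  define K where "K c w z = (case z of (rs, a, b) \<Rightarrow>
      let x = (alpha xs (rho' w) (trA xs (rho' w) (a' w) c) + fst rs) mod p;
          yy = (beta y c + snd rs) mod p
      in complex_of_real (P a b x yy / real p ^ 2) * phi c ((b + (p - a) + f x yy) mod p))" for c w z
  have step: "(\<Sum>z\<in>({..<p} \<times> {..<p}) \<times> {..<p} \<times> {..<p}. K c w z) = (if c \<in> S then nu_hat k else 1)" for c w
    unfolding K_def Let_def nu_sum_eq using sum_nu by (simp add: phi_def nu_hat_def)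
  have "(\<Sum>rho\<in>PiE {..<M} (\<lambda>_. {..<p} \<times> {..<p}). \<Sum>a\<in>PiE {..<M} (\<lambda>_. {..<p}). \<Sum>b\<in>PiE {..<M} (\<lambda>_. {..<p}).
      complex_of_real ((1 / real p ^ 2) ^ M * (\<Prod>c<M. P (a c) (b c) (XA xs rho a c) (inB y rho c)))
       * omega p ^ ((\<Sum>j\<in>decode_path D n y. err xs y rho a b (M - j)) * k))
    = (\<Sum>rho\<in>PiE {..<M} (\<lambda>_. {..<p} \<times> {..<p}). \<Sum>a\<in>PiE {..<M} (\<lambda>_. {..<p}). \<Sum>b\<in>PiE {..<M} (\<lambda>_. {..<p}).
       \<Prod>c<M. K c (\<lambda>i\<in>{..<M}. (rho i, (\<lambda>i\<in>{..<M}. (a i, b i)) i))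
          ((\<lambda>i\<in>{..<M}. (rho i, (\<lambda>i\<in>{..<M}. (a i, b i)) i)) c))"
  proof (intro sum.cong refl)
    fix rho :: "nat \<Rightarrow> nat \<times> nat" and a b :: "nat \<Rightarrow> nat"
    define w where "w = (\<lambda>i\<in>{..<M}. (rho i, (\<lambda>i\<in>{..<M}. (a i, b i)) i))"
    have "(\<Sum>j\<in>decode_path D n y. err xs y rho a b (M - j)) = (\<Sum>c\<in>S. err xs y rho a b c)"
      unfolding S_def using inj by (simp add: sum.reindex)
    then have "omega p ^ ((\<Sum>j\<in>decode_path D n y. err xs y rho a b (M - j)) * k)
        = (\<Prod>c\<in>S. omega p ^ (err xs y rho a b c * k))"
      by (simp add: sum_distrib_right power_sum)
    also have "\<dots> = (\<Prod>c<M. phi c (err xs y rho a b c))"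
      using SM unfolding phi_def by (simp add: prod.If_cases Int_absorb1)
    finally have om: "omega p ^ ((\<Sum>j\<in>decode_path D n y. err xs y rho a b (M - j)) * k)
      = (\<Prod>c<M. phi c (err xs y rho a b c))" .
    have "K c w (w c) = complex_of_real (P (a c) (b c) (XA xs rho a c) (inB y rho c) / real p ^ 2)
        * phi c (err xs y rho a b c)" if c: "c < M" for c
    proof -
      have "alpha xs (rho' w) (trA xs (rho' w) (a' w) c) = alpha xs rho (trA xs rho a c)"
        using c by (intro alpha_trA_cong) (auto simp: w_def rho'_def a'_def)
      moreover have "w c = (rho c, a c, b c)" using c by (simp add: w_def)
      ultimately show ?thesis
        using c by (simp add: K_def Let_def XA_eq inB_def err_def)
    qed
    then have "(\<Prod>c<M. K c w (w c)) = (\<Prod>c<M. complex_of_real (P (a c) (b c) (XA xs rho a c) (inB y rho c) / real p ^ 2)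
        * phi c (err xs y rho a b c))" by simp
    also have "\<dots> = complex_of_real ((1 / real p ^ 2) ^ M * (\<Prod>c<M. P (a c) (b c) (XA xs rho a c) (inB y rho c)))
      * (\<Prod>c<M. phi c (err xs y rho a b c))"
      by (simp add: prod.distrib prod_dividef power_divide)
    finally show "complex_of_real ((1 / real p ^ 2) ^ M * (\<Prod>c<M. P (a c) (b c) (XA xs rho a c) (inB y rho c)))
       * omega p ^ ((\<Sum>j\<in>decode_path D n y. err xs y rho a b (M - j)) * k)
     = (\<Prod>c<M. K c (\<lambda>i\<in>{..<M}. (rho i, (\<lambda>i\<in>{..<M}. (a i, b i)) i))
          ((\<lambda>i\<in>{..<M}. (rho i, (\<lambda>i\<in>{..<M}. (a i, b i)) i)) c))"
      unfolding om w_def by simp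
  qed
  also have "\<dots> = (\<Sum>rho\<in>PiE {..<M} (\<lambda>_. {..<p} \<times> {..<p}). \<Sum>ab\<in>PiE {..<M} (\<lambda>_. {..<p} \<times> {..<p}).
       \<Prod>c<M. K c (\<lambda>i\<in>{..<M}. (rho i, ab i)) ((\<lambda>i\<in>{..<M}. (rho i, ab i)) c))"
    by (rule sum.cong[OF refl]) (rule sum_PiE_Times[symmetric])
  also have "\<dots> = (\<Sum>w\<in>PiE {..<M} (\<lambda>_. ({..<p} \<times> {..<p}) \<times> {..<p} \<times> {..<p}). \<Prod>c<M. K c w (w c))"
    by (rule sum_PiE_Times[symmetric])
  also have "\<dots> = (\<Prod>c<M. if c \<in> S then nu_hat k else 1)"
  proof (rule sum_PiE_adaptive_prod)
    fix c and w w' :: "nat \<Rightarrow> (nat \<times> nat) \<times> nat \<times> nat" and z :: "(nat \<times> nat) \<times> nat \<times> nat"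
    assume c: "c < M" and eq: "\<And>i. i < c \<Longrightarrow> w i = w' i"
    have "alpha xs (rho' w) (trA xs (rho' w) (a' w) c) = alpha xs (rho' w') (trA xs (rho' w') (a' w') c)"
      using c eq by (intro alpha_trA_cong) (auto simp: rho'_def a'_def)
    then show "K c w z = K c w' z" by (simp add: K_def)
  qed (rule step)
  also have "\<dots> = nu_hat k ^ card S"
    using SM by (simp add: prod.If_cases Int_absorb1)
  finally show ?thesis by (simp add: cardS)
qed

section \<open>The joint distribution of input and output\<close>

lemma decB_cong:
  assumes eq: "\<And>c. c < M \<Longrightarrow> b c = b' c"
  shows "decB y q rho b = decB y q rho b'"
proof -
  have 1: "M - j < M" if "j \<in> decode_path D n y" for j
  proof -
    have "j \<in> {1..<D ^ n}" by (rule subsetD[OF decode_path_subset[OF D0] that])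
    then show "M - j < M" unfolding atLeastLessThan_iff by linarith
  qed
  have "b (M - j) = b' (M - j)" if "j \<in> decode_path D n y" for j
    by (rule eq, rule 1, rule that)
  then show ?thesis unfolding decB_def by simp
qed

text \<open>Shared randomness is a number in \<open>ic_joint\<close>; \<open>e\<close> decodes it
  into a table of shifts, all tables having equal weight.\<close>

definition joint :: "nat \<Rightarrow> (nat \<Rightarrow> nat \<Rightarrow> nat \<times> nat) \<Rightarrow> nat \<Rightarrow> nat \<Rightarrow> nat \<Rightarrow> real" where
  "joint R e = ic_joint p P (D ^ n) M R (\<lambda>_. (1 / real p ^ 2) ^ M)
     (\<lambda>_ _. length) (\<lambda>xs r. inA xs (e r)) (\<lambda>xs r. msg xs (e r))
     (\<lambda>_ _ _. length) (\<lambda>y _ r H. inB y (e r) (length H)) (\<lambda>y q r H. decB y q (e r) (\<lambda>c. snd (snd (H ! c))))"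

lemma joint_eq:
  assumes e: "bij_betw e {..<R} (PiE {..<M} (\<lambda>_. {..<p} \<times> {..<p}))"
  shows "joint R e y u v = (\<Sum>xs\<in>PiE {..<D ^ n} (\<lambda>_. {..<p}). if xs y \<noteq> u then 0 else
     (\<Sum>rho\<in>PiE {..<M} (\<lambda>_. {..<p} \<times> {..<p}). \<Sum>a\<in>PiE {..<M} (\<lambda>_. {..<p}). \<Sum>b\<in>PiE {..<M} (\<lambda>_. {..<p}).
        if decB y (msg xs rho (trA xs rho a M)) rho b mod p = v then
          (1 / real p ^ (D ^ n)) * (1 / real p ^ 2) ^ M * (\<Prod>c<M. P (a c) (b c) (XA xs rho a c) (inB y rho c))
        else 0))"
proof -
  have hB: "run p M length (\<lambda>H. inB y rho (length H)) b k = map (\<lambda>c. (c, inB y rho c, b c)) [0..<k]"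
    if "k \<le> M" for k rho b
  proof -
    have len: "length (run p M length (\<lambda>H. inB y rho (length H)) b c) = c" if "c \<le> M" for c
      using that by (subst run_in_order) auto
    show ?thesis
    proof (subst run_in_order[OF that], rule map_cong[OF refl])
      fix c assume "c \<in> set [0..<k]"
      then have "c \<le> M" using that by simp
      then show "(c, inB y rho (length (run p M length (\<lambda>H. inB y rho (length H)) b c)) mod p, b c)
          = (c, inB y rho c, b c)"
        by (simp only: len mod_less[OF inB_less])
    qed
  qed
  have msgp: "msg xs rho H mod p = msg xs rho H" for xs rho H
  proof -
    have "msg xs rho H < p" using p2 by (simp add: msg_def nat_less_iff)
    then show ?thesis by simp
  qed
  have dec: "decB y q rho (\<lambda>c. snd (snd (map (\<lambda>c. (c, inB y rho c, b c)) [0..<M] ! c))) = decB y q rho b" for q rho b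
    by (rule decB_cong) simp
  have prods: "(\<Prod>c<M. P (a c) (b c) (inp_of (trA xs rho a M) c) (inp_of (map (\<lambda>c. (c, inB y rho c, b c)) [0..<M]) c))
      = (\<Prod>c<M. P (a c) (b c) (XA xs rho a c) (inB y rho c))" for a b xs rho
    by (intro prod.cong refl) (simp add: inp_of_map_upt trA_eq)
  show ?thesis
    unfolding joint_def ic_joint_def Let_def hB[OF order_refl] trA_def[symmetric] msgp dec prods
    by (subst sum.reindex_bij_betw[OF e, symmetric]) (rule refl)
qed

lemma joint_nonneg:
  assumes e: "bij_betw e {..<R} (PiE {..<M} (\<lambda>_. {..<p} \<times> {..<p}))"
  shows "0 \<le> joint R e y u v"
proof -
  have "0 \<le> P (a c) (b c) (XA xs rho a c) (inB y rho c)"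
    if "a \<in> PiE {..<M} (\<lambda>_. {..<p})" "b \<in> PiE {..<M} (\<lambda>_. {..<p})" "c < M" for a b c xs rho
  proof -
    have "a c < p" "b c < p" using that by (auto simp: PiE_iff)
    then show ?thesis using box XA_less inB_less by (simp add: is_box_def)
  qed
  then have "0 \<le> (1 / real p ^ (D ^ n)) * (1 / real p ^ 2) ^ M
      * (\<Prod>c<M. P (a c) (b c) (XA xs rho a c) (inB y rho c))"
    if "a \<in> PiE {..<M} (\<lambda>_. {..<p})" "b \<in> PiE {..<M} (\<lambda>_. {..<p})" for a b xs rho
    using that by (intro mult_nonneg_nonneg prod_nonneg) simp_all
  then show ?thesis unfolding joint_eq[OF e]
    by (auto intro!: sum_nonneg simp del: One_nat_def)
qed

text \<open>By Fourier inversion, the probability that \<open>n * (D - 1)\<close> independent errors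
  of law \<open>nu\<close> add up to \<open>-c\<close> modulo \<open>p\<close>.\<close>

definition err_dist :: "nat \<Rightarrow> complex" where
  "err_dist c = (1 / of_nat p) * (\<Sum>k<p. omega p ^ (c * k) * nu_hat k ^ (n * (D - 1)))"

text \<open>The event that Bob outputs \<open>v\<close> is expanded in characters, and the sum over
  \<open>k\<close> is moved outermost so that \<open>character_sum\<close> evaluates the
  rest.\<close>

lemma joint_eq_err_dist:
  assumes e: "bij_betw e {..<R} (PiE {..<M} (\<lambda>_. {..<p} \<times> {..<p}))"
    and y: "y < D ^ n" and u: "u < p" and v: "v < p"
  shows "complex_of_real (joint R e y u v) = err_dist (v + (p - u)) / of_nat p"
proof -
  have p0: "0 < p" using p2 by simp
  let ?w = "\<lambda>xs rho a b. (1 / real p ^ 2) ^ M * (\<Prod>c<M. P (a c) (b c) (XA xs rho a c) (inB y rho c))"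
  let ?S = "\<lambda>xs rho a b. \<Sum>j\<in>decode_path D n y. err xs y rho a b (M - j)"
  let ?s = "v + (p - u)"
  let ?Rho = "PiE {..<M} (\<lambda>_. {..<p} \<times> {..<p})"
  let ?A = "PiE {..<M} (\<lambda>_. {..<p})"
  have inner: "complex_of_real (\<Sum>rho\<in>?Rho. \<Sum>a\<in>?A. \<Sum>b\<in>?A.
        if decB y (msg xs rho (trA xs rho a M)) rho b mod p = v then
          (1 / real p ^ (D ^ n)) * (1 / real p ^ 2) ^ M * (\<Prod>c<M. P (a c) (b c) (XA xs rho a c) (inB y rho c))
        else 0) = err_dist ?s / of_nat p ^ (D ^ n)" if xs: "xs y = u" for xs
  proof -
    have "complex_of_real (\<Sum>rho\<in>?Rho. \<Sum>a\<in>?A. \<Sum>b\<in>?A.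
        if decB y (msg xs rho (trA xs rho a M)) rho b mod p = v then
          (1 / real p ^ (D ^ n)) * (1 / real p ^ 2) ^ M * (\<Prod>c<M. P (a c) (b c) (XA xs rho a c) (inB y rho c))
        else 0)
      = (\<Sum>rho\<in>?Rho. \<Sum>a\<in>?A. \<Sum>b\<in>?A. \<Sum>k<p.
          (omega p ^ (?s * k) / (of_nat p * of_nat p ^ (D ^ n)))
            * (complex_of_real (?w xs rho a b) * omega p ^ (?S xs rho a b * k)))"
      unfolding of_real_sum
    proof (intro sum.cong refl)
      fix rho a b assume a: "a \<in> ?A"
      have "(\<Sum>k<p. (omega p ^ (?s * k) / (of_nat p * of_nat p ^ (D ^ n)))
            * (complex_of_real (?w xs rho a b) * omega p ^ (?S xs rho a b * k)))
        = complex_of_real (?w xs rho a b) / (of_nat p * of_nat p ^ (D ^ n))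
            * (\<Sum>k<p. omega p ^ ((?s + ?S xs rho a b) * k))"
        unfolding sum_distrib_left add_mult_distrib power_add by (intro sum.cong refl) simp
      also have "\<dots> = complex_of_real (?w xs rho a b) / (of_nat p * of_nat p ^ (D ^ n))
            * (if p dvd ?s + ?S xs rho a b then of_nat p else 0)"
        by (simp only: sum_omega_powers[OF p0])
      also have "p dvd ?s + ?S xs rho a b \<longleftrightarrow> decB y (msg xs rho (trA xs rho a M)) rho b mod p = v"
        using output_eq_iff[OF y _ _ v, of a xs rho b] a u xs by (auto simp: PiE_iff)
      finally show "complex_of_real (if decB y (msg xs rho (trA xs rho a M)) rho b mod p = v then
          (1 / real p ^ (D ^ n)) * (1 / real p ^ 2) ^ M * (\<Prod>c<M. P (a c) (b c) (XA xs rho a c) (inB y rho c))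
        else 0) = (\<Sum>k<p. (omega p ^ (?s * k) / (of_nat p * of_nat p ^ (D ^ n)))
            * (complex_of_real (?w xs rho a b) * omega p ^ (?S xs rho a b * k)))"
        using p0 by simp
    qed
    also have "\<dots> = (\<Sum>rho\<in>?Rho. \<Sum>a\<in>?A. \<Sum>k<p. \<Sum>b\<in>?A.
          (omega p ^ (?s * k) / (of_nat p * of_nat p ^ (D ^ n)))
            * (complex_of_real (?w xs rho a b) * omega p ^ (?S xs rho a b * k)))"
      by (intro sum.cong[OF refl] sum.swap)
    also have "\<dots> = (\<Sum>rho\<in>?Rho. \<Sum>k<p. \<Sum>a\<in>?A. \<Sum>b\<in>?A.
          (omega p ^ (?s * k) / (of_nat p * of_nat p ^ (D ^ n)))
            * (complex_of_real (?w xs rho a b) * omega p ^ (?S xs rho a b * k)))"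
      by (intro sum.cong[OF refl] sum.swap)
    also have "\<dots> = (\<Sum>k<p. \<Sum>rho\<in>?Rho. \<Sum>a\<in>?A. \<Sum>b\<in>?A.
          (omega p ^ (?s * k) / (of_nat p * of_nat p ^ (D ^ n)))
            * (complex_of_real (?w xs rho a b) * omega p ^ (?S xs rho a b * k)))"
      by (rule sum.swap)
    also have "\<dots> = (\<Sum>k<p. (omega p ^ (?s * k) / (of_nat p * of_nat p ^ (D ^ n))) * nu_hat k ^ (n * (D - 1)))"
      unfolding sum_distrib_left[symmetric] character_sum ..
    also have "\<dots> = err_dist ?s / of_nat p ^ (D ^ n)"
      by (simp add: err_dist_def sum_divide_distrib sum_distrib_left)
    finally show ?thesis .
  qed
  let ?B = "PiE {..<D ^ n} (\<lambda>_. {..<p})"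
  have "complex_of_real (joint R e y u v) = (\<Sum>xs\<in>?B. if xs y = u then err_dist ?s / of_nat p ^ (D ^ n) else 0)"
    unfolding joint_eq[OF e] of_real_sum[of _ ?B] using inner by (intro sum.cong refl) auto
  also have "\<dots> = (\<Sum>xs\<in>{xs\<in>?B. xs y = u}. err_dist ?s / of_nat p ^ (D ^ n))"
    by (rule sum.inter_filter[symmetric]) (simp add: finite_PiE)
  \<comment> \<open>With \<open>N = D ^ n\<close>, there are \<open>p ^ (N - 1)\<close> inputs with
    the prescribed component, each of weight \<open>1 / p ^ N\<close>.\<close>
  also have "\<dots> = of_nat p ^ (D ^ n - 1) * (err_dist ?s / of_nat p ^ (D ^ n))"
    using card_PiE_fixed_component[OF y u] by simp
  also have "\<dots> = err_dist ?s / of_nat p"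
  proof -
    have "(of_nat p :: complex) ^ (D ^ n) = of_nat p * of_nat p ^ (D ^ n - 1)"
      using D0 by (simp flip: power_Suc)
    then show ?thesis using p0 by simp
  qed
  finally show ?thesis .
qed

lemma err_dist_mod: "err_dist (c mod p) = err_dist c"
proof -
  have "omega p ^ (c mod p * k) = omega p ^ (c * k)" for k
  proof -
    have "omega p ^ p = 1" using p2 omega_power_eq_1_iff[of p p] by simp
    then have "omega p ^ (p * (c div p * k) + c mod p * k) = omega p ^ (c mod p * k)"
      by (simp only: power_add power_mult) simp
    moreover have "p * (c div p * k) + c mod p * k = c * k"
      by (metis add_mult_distrib mult.assoc mult_div_mod_eq)
    ultimately show ?thesis by simp
  qed
  then show ?thesis by (simp add: err_dist_def)
qed

lemma sum_err_dist: "(\<Sum>c<p. err_dist c) = 1"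
proof -
  have p0: "0 < p" using p2 by simp
  have "(\<Sum>c<p. err_dist c) = (1 / of_nat p) * (\<Sum>c<p. \<Sum>k<p. omega p ^ (c * k) * nu_hat k ^ (n * (D - 1)))"
    by (simp add: err_dist_def sum_distrib_left)
  also have "(\<Sum>c<p. \<Sum>k<p. omega p ^ (c * k) * nu_hat k ^ (n * (D - 1)))
      = (\<Sum>k<p. (\<Sum>c<p. omega p ^ (k * c)) * nu_hat k ^ (n * (D - 1)))"
    by (subst sum.swap) (simp add: sum_distrib_right mult.commute)
  also have "\<dots> = (\<Sum>k<p. if k = 0 then of_nat p * nu_hat k ^ (n * (D - 1)) else 0)"
    by (intro sum.cong refl) (auto simp: sum_omega_powers[OF p0] dest: dvd_imp_le)
  also have "\<dots> = of_nat p" using p0 sum_nu by (simp add: nu_hat_def)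
  finally show ?thesis using p0 by simp
qed

text \<open>All \<open>D ^ n\<close> mutual informations equal \<open>log 2 p\<close> minus the
  entropy of one law \<open>q\<close>, so information causality becomes a lower bound on that
  entropy.\<close>

lemma err_dist_le_T_inv:
  assumes ic: "info_causality p P" and c: "c < p"
  shows "err_dist c \<le> complex_of_real (T_inv p ((real (D ^ n) - 1) / real (D ^ n) * log 2 (real p)))"
proof -
  have p0: "0 < p" using p2 by simp
  let ?Rho = "PiE {..<M} (\<lambda>_. {..<p} \<times> {..<p})"
  let ?N = "D ^ n"
  have N: "1 \<le> ?N" using D0 by (simp add: Suc_leI)
  have "finite ?Rho" by (intro finite_PiE) auto
  then obtain e where e: "bij_betw e {..<card ?Rho} ?Rho"
    using ex_bij_betw_nat_finite by (metis atLeast0LessThan)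
  define R where "R = card ?Rho"
  note e = e[folded R_def]
  have cardR: "R = (p ^ 2) ^ M" unfolding R_def
    by (subst card_PiE) (auto simp: card_cartesian_product power2_eq_square)
  \<comment> \<open>The law is read off the row \<open>u = 0\<close> at \<open>y = 0\<close>, and
    the factor \<open>p\<close> undoes the uniform weight of the input. This shows that
    \<open>err_dist\<close> is real and nonnegative.\<close>
  define q where "q c = real p * joint R e 0 0 c" for c
  have q_dist: "complex_of_real (q c) = err_dist c" if "c < p" for c
    using joint_eq_err_dist[OF e _ p0 that, of 0] err_dist_mod[of "c + p"] err_dist_mod[of c] p0 D0
    by (simp add: q_def)
  have q0: "0 \<le> q c" for c by (simp add: q_def joint_nonneg[OF e])
  have "complex_of_real (\<Sum>c<p. q c) = 1" using q_dist sum_err_dist by simp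
  then have q1: "(\<Sum>c<p. q c) = 1" using of_real_eq_1_iff by blast
  have J: "joint R e y u v = q ((v + (p - u)) mod p) / real p" if "y < ?N" "u < p" "v < p" for y u v
  proof -
    have "complex_of_real (joint R e y u v) = complex_of_real (q ((v + (p - u)) mod p) / real p)"
      using joint_eq_err_dist[OF e that] q_dist[of "(v + (p - u)) mod p"] p0 by (simp add: err_dist_mod)
    then show ?thesis using of_real_eq_iff by blast
  qed
  let ?H = "\<Sum>c<p. q c * log 2 (q c)"
  have MI: "mutual_info p (joint R e y) = log 2 (real p) + ?H" if "y < ?N" for y
    by (rule mutual_info_shift_invariant[OF p0 q0 q1 J[OF that]])
  have "(\<Sum>r<R. (1 / real p ^ 2) ^ M) = 1" using p0 by (simp add: cardR power_divide)
  then have "(\<Sum>y<?N. mutual_info p (joint R e y)) \<le> log 2 (real p)"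
    using ic[unfolded info_causality_def] N unfolding joint_def by simp
  then have "real ?N * (log 2 (real p) + ?H) \<le> log 2 (real p)" using MI by simp
  then have "(real ?N - 1) * log 2 (real p) \<le> real ?N * (- ?H)" by (simp add: algebra_simps)
  moreover have "0 < real ?N" using D0 by simp
  ultimately have "(real ?N - 1) / real ?N * log 2 (real p) \<le> - ?H"
    by (simp only: times_divide_eq_left pos_divide_le_eq mult.commute[of "- ?H"])
  also have "\<dots> \<le> T_fun p (q c)" by (rule entropy_le_T_fun[OF q0 q1 c])
  finally have T: "(real ?N - 1) / real ?N * log 2 (real p) \<le> T_fun p (q c)" .
  have "q c \<le> 1" using q1 q0 c member_le_sum[of c "{..<p}" q] by simp
  moreover have "0 \<le> (real ?N - 1) / real ?N" "(real ?N - 1) / real ?N \<le> 1"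
  proof -
    have "0 \<le> (t - 1) / t \<and> (t - 1) / t \<le> 1" if "1 \<le> t" for t :: real
      using that by (simp add: field_simps)
    moreover have "1 \<le> real ?N" using of_nat_mono[OF N] by (simp only: of_nat_1)
    ultimately show "0 \<le> (real ?N - 1) / real ?N" "(real ?N - 1) / real ?N \<le> 1" by blast+
  qed
  moreover have "0 \<le> log 2 (real p)" using p2 by simp
  ultimately have "q c \<le> T_inv p ((real ?N - 1) / real ?N * log 2 (real p))"
    using T p2 by (intro le_T_inv mult_nonneg_nonneg mult_left_le_one_le) auto
  \<comment> \<open>The order on complex numbers also demands equal imaginary parts; this holds
    because \<open>err_dist c\<close> is the real number \<open>q c\<close>.\<close>
  then show ?thesis by (simp add: q_dist[OF c, symmetric] less_eq_complex_def)
qed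

end

theorem theorem4:
  fixes p :: nat and f :: "nat \<Rightarrow> nat \<Rightarrow> nat" and P :: "nat \<Rightarrow> nat \<Rightarrow> nat \<Rightarrow> nat \<Rightarrow> real"
  assumes "prime p"
    and "\<forall>x<p. \<forall>y<p. f x y < p"
    and "\<not> add_separable p f"
    and "Delta p f = 2"
    and "is_box p P"
    and "no_signalling p P"
    and "info_causality p P"
  shows "(\<forall>N c. 1 \<le> N \<longrightarrow> N \<le> p \<longrightarrow> c < p \<longrightarrow>
            (1 / of_nat p) * (\<Sum>k<p. omega p ^ (c * k) *
               (\<Sum>j<p. complex_of_real (nu p f P j) * omega p ^ (j * k)) ^ (N - 1))
            \<le> complex_of_real (T_inv p ((real N - 1) / real N * log 2 (real p))))
       \<and> (\<forall>n c. 1 \<le> n \<longrightarrow> c < p \<longrightarrow>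
            (1 / of_nat p) * (\<Sum>k<p. omega p ^ (c * k) *
               (\<Sum>j<p. complex_of_real (nu p f P j) * omega p ^ (j * k)) ^ (n * (p - 1)))
            \<le> complex_of_real (T_inv p ((real (p ^ n) - 1) / real (p ^ n) * log 2 (real p))))"
proof -
  have p2: "2 \<le> p" using assms(1) prime_ge_2_nat by blast
  obtain lam g h where lam: "\<not> p dvd lam"
    and f_eq: "\<And>x y. x < p \<Longrightarrow> y < p \<Longrightarrow> f x y = (lam * x * y + g x + h y) mod p"
    using Delta_eq_2_decomp[OF assms(1,2,4)] by metis
  have "coprime lam p" using lam assms(1) by (meson coprime_commute prime_imp_coprime)
  then obtain mu where mu: "[lam * mu = 1] (mod p)" using cong_solve_coprime_nat by auto
  have main: "(1 / of_nat p) * (\<Sum>k<p. omega p ^ (c * k) *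
         (\<Sum>j<p. complex_of_real (nu p f P j) * omega p ^ (j * k)) ^ (n * (D - 1)))
      \<le> complex_of_real (T_inv p ((real (D ^ n) - 1) / real (D ^ n) * log 2 (real p)))"
    if "0 < D" "c < p" for D n c
  proof -
    interpret tree_protocol p lam mu D n f g h P
      using p2 that f_eq mu assms(5) by unfold_locales auto
    show ?thesis using err_dist_le_T_inv[OF assms(7) that(2)] by (simp only: err_dist_def nu_hat_def)
  qed
  show ?thesis
    using main[of _ _ 1] main[of p] p2 by (simp add: less_eq_Suc_le)
qed

end
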